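(* Let $h$ be a holomorphic cusp form on $\mathcal H$ of weight $(k,k)$ and put $\kappa=k+2$. For $\kappa=k+2\ge 4$, Sturm's operator (of weight $\kappa$) applied to the nonholomorphic image $\Delta_+^{[2]}(h)$ is zero, but for $\kappa=3$ it does not vanish.
   Context: $\mathcal H=\{Z=X+iY\in M_2(\mathbb C): Z=Z',\ Y>0\}$ is the Siegel upper half space of genus $2$ ($'$ denotes transpose), $\Gamma$ is a subgroup of finite index in $\mathrm{Sp}_2(\mathbb Z)\subset M_{4}(\mathbb Z)$ containing $\Gamma_\infty=\left\{\begin{pmatrix}\pm E_2&*\\0&\pm E_2\end{pmatrix}\in\mathrm{Sp}_2(\mathbb Z)\right\}$, and cusp forms are taken with respect to $\Gamma$. A function $F$ on $\mathcal H$ has weight $\kappa$ (or $(\kappa,\kappa)$) if $F(\gamma Z)=\det(cZ+d)^\kappa F(Z)$ for all $\gamma=\begin{pmatrix}a&b\\c&d\end{pmatrix}\in\Gamma$. Maass operator: for $h$ of scalar weight $(k,k)$, $$\Delta_+^{[2]}(h)(Z)=-4\det(Y)^{\frac12-k}\,\det(\partial_Z)\left(\det(Y)^{k-\frac12}h(Z)\right),$$ where $\partial_Z$ is the symmetric $2\times2$ matrix of operators with entries $\frac12(1+\delta_{ij})\frac{\partial}{\partial Z_{ij}}$. It maps forms of weight $(k,k)$ to (nonholomorphic) forms of weight $(k+2,k+2)$. Sturm's operator of weight $\kappa$: for a (nonholomorphic) modular form $F$ of weight $\kappa$ with Fourier expansion $F(Z)=\sum_{T=T'}A(T,Y)\exp(2\pi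 i\,\mathrm{tr}(TX))$, it assigns to $F$ the coefficients, for positive definite $T$, $$a(T)=c(\kappa)^{-1}\int_{\mathcal Y}A(T,Y)\exp(-2\pi\,\mathrm{tr}(TY))\det(TY)^{\kappa-\frac32}\frac{dY}{\det(Y)^{3/2}},$$ where $\mathcal Y$ is the set of positive definite symmetric real $2\times2$ matrices, $dY=dY_{11}dY_{12}dY_{22}$, and $c(\kappa)\ne0$ is a constant depending only on $\kappa$, chosen such that Sturm's operator is the identity on Fourier coefficients of holomorphic forms.
   Formalization: For κ=3 Sturm's integral does not converge absolutely, so its coefficients are read as the limit s→0+ of the integrals with the convergence factor det(Y)^s inserted; also for κ=3, h is assumed not identically zero. *)

theory Defs
  imports "HOL-Analysis.Analysis" "HOL-Algebra.Coset"
begin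

section \<open>Symmetric matrices and the Siegel upper half space of genus 2\<close>

definition posdef :: "real^2^2 \<Rightarrow> bool" where
  "posdef Y \<longleftrightarrow> transpose Y = Y \<and> (\<forall>v. v \<noteq> 0 \<longrightarrow> v \<bullet> (Y *v v) > 0)"

definition Im_mat :: "complex^2^2 \<Rightarrow> real^2^2" where
  "Im_mat Z = (\<chi> i j. Im (Z $ i $ j))"

definition complex_mat :: "real^2^2 \<Rightarrow> real^2^2 \<Rightarrow> complex^2^2" where
  "complex_mat X Y = (\<chi> i j. Complex (X $ i $ j) (Y $ i $ j))"

definition siegel_H :: "(complex^2^2) set" where
  "siegel_H = {Z. transpose Z = Z \<and> posdef (Im_mat Z)}"

text \<open>Coordinates \<open>(Y\<^sub>1\<^sub>1, Y\<^sub>1\<^sub>2, Y\<^sub>2\<^sub>2)\<close> on the real symmetric matrices; Lebesgue measure on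
  \<^typ>\<open>real \<times> real \<times> real\<close> is then \<open>dY = dY\<^sub>1\<^sub>1 dY\<^sub>1\<^sub>2 dY\<^sub>2\<^sub>2\<close>.\<close>

definition sym_mat :: "real \<times> real \<times> real \<Rightarrow> real^2^2" where
  "sym_mat y = (case y of (a, b, c) \<Rightarrow> vector [vector [a, b], vector [b, c]])"

definition pos_cone :: "(real \<times> real \<times> real) set" where
  "pos_cone = {y. posdef (sym_mat y)}"

text \<open>\<open>H\<close> is open in the space of symmetric matrices, so the derivative within \<open>H\<close> is determined
  on that space, and complex linearity there is holomorphy in the three variables
  \<open>Z\<^sub>1\<^sub>1, Z\<^sub>1\<^sub>2, Z\<^sub>2\<^sub>2\<close>.\<close>

definition siegel_holomorphic :: "(complex^2^2 \<Rightarrow> complex) \<Rightarrow> bool" where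
  "siegel_holomorphic h \<longleftrightarrow>
     (\<forall>Z\<in>siegel_H. \<exists>D. (h has_derivative D) (at Z within siegel_H) \<and>
        (\<forall>c V. D (\<chi> i j. c * V $ i $ j) = c * D V))"


section \<open>The symplectic group and modular forms\<close>

text \<open>Matrices in \<open>M\<^sub>4(\<int>)\<close> are indexed by the sum type \<^typ>\<open>2 + 2\<close>, so that the four
  \<open>2 \<times> 2\<close> blocks are read off by the two injections.\<close>

type_synonym int_mat4 = "int^(2 + 2)^(2 + 2)"

definition blk_a :: "int_mat4 \<Rightarrow> int^2^2" where "blk_a M = (\<chi> i j. M $ Inl i $ Inl j)"
definition blk_b :: "int_mat4 \<Rightarrow> int^2^2" where "blk_b M = (\<chi> i j. M $ Inl i $ Inr j)"
definition blk_c :: "int_mat4 \<Rightarrow> int^2^2" where "blk_c M = (\<chi> i j. M $ Inr i $ Inl j)"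
definition blk_d :: "int_mat4 \<Rightarrow> int^2^2" where "blk_d M = (\<chi> i j. M $ Inr i $ Inr j)"

definition sympl_J :: int_mat4 where
  "sympl_J = (\<chi> p q. case (p, q) of
      (Inl i, Inr j) \<Rightarrow> (if i = j then 1 else 0)
    | (Inr i, Inl j) \<Rightarrow> (if i = j then -1 else 0)
    | _ \<Rightarrow> 0)"

definition Sp2Z :: "int_mat4 monoid" where
  "Sp2Z = \<lparr>carrier = {M. transpose M ** sympl_J ** M = sympl_J}, mult = (**), one = mat 1\<rparr>"

definition Gamma_inf :: "int_mat4 set" where
  "Gamma_inf = {M \<in> carrier Sp2Z. blk_c M = 0 \<and>
     (blk_a M = mat 1 \<or> blk_a M = - mat 1) \<and> (blk_d M = mat 1 \<or> blk_d M = - mat 1)}"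

definition cint :: "int^2^2 \<Rightarrow> complex^2^2" where
  "cint M = (\<chi> i j. of_int (M $ i $ j))"

definition aut_factor :: "int_mat4 \<Rightarrow> complex^2^2 \<Rightarrow> complex" where
  "aut_factor M Z = det (cint (blk_c M) ** Z + cint (blk_d M))"

definition moebius :: "int_mat4 \<Rightarrow> complex^2^2 \<Rightarrow> complex^2^2" where
  "moebius M Z = (cint (blk_a M) ** Z + cint (blk_b M)) **
                 matrix_inv (cint (blk_c M) ** Z + cint (blk_d M))"

definition has_weight :: "int_mat4 set \<Rightarrow> nat \<Rightarrow> (complex^2^2 \<Rightarrow> complex) \<Rightarrow> bool" where
  "has_weight \<Gamma> \<kappa> F \<longleftrightarrow>
     (\<forall>\<gamma>\<in>\<Gamma>. \<forall>Z\<in>siegel_H. F (moebius \<gamma> Z) = aut_factor \<gamma> Z ^ \<kappa> * F Z)"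

text \<open>The lattice of half-integral symmetric matrices, dual to the translation lattice
  \<open>{X = X' integral}\<close> with respect to the trace form.\<close>

definition half_integral :: "real^2^2 \<Rightarrow> bool" where
  "half_integral T \<longleftrightarrow> transpose T = T \<and> T $ 1 $ 1 \<in> \<int> \<and> T $ 2 $ 2 \<in> \<int> \<and> 2 * T $ 1 $ 2 \<in> \<int>"

text \<open>A holomorphic form is cuspidal if at every cusp, that is for every \<open>h|M\<close> with
  \<open>M \<in> Sp\<^sub>2(\<int>)\<close>, only positive definite \<open>T\<close> occur in the Fourier expansion. The form \<open>h|M\<close> is
  periodic only under \<open>N\<close> times the integral symmetric matrices for some \<open>N > 0\<close>, whence the
  denominators \<open>N\<close> in \<open>T\<close>.\<close>

definition cusp_form :: "int_mat4 set \<Rightarrow> nat \<Rightarrow> (complex^2^2 \<Rightarrow> complex) \<Rightarrow> bool" where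
  "cusp_form \<Gamma> k h \<longleftrightarrow> siegel_holomorphic h \<and> has_weight \<Gamma> k h \<and>
     (\<forall>M\<in>carrier Sp2Z. \<exists>N>0::nat. \<exists>c. \<forall>Z\<in>siegel_H.
        ((\<lambda>T. c T * exp (2 * pi * \<i> * trace (complex_mat T 0 ** Z)))
           has_sum (h (moebius M Z) / aut_factor M Z ^ k))
        {T. posdef T \<and> half_integral (real N *\<^sub>R T)})"


section \<open>The Maass operator\<close>

definition dir_deriv :: "complex^2^2 \<Rightarrow> (complex^2^2 \<Rightarrow> complex) \<Rightarrow> complex^2^2 \<Rightarrow> complex" where
  "dir_deriv V F Z = vector_derivative (\<lambda>t::real. F (Z + t *\<^sub>R V)) (at 0)"

text \<open>Change of the coordinate \<open>Z\<^sub>i\<^sub>j = Z\<^sub>j\<^sub>i\<close> of a symmetric matrix by \<open>u\<close>.\<close>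

definition coord_mat :: "2 \<Rightarrow> 2 \<Rightarrow> complex \<Rightarrow> complex^2^2" where
  "coord_mat i j u = (\<chi> p q. if (p, q) = (i, j) \<or> (p, q) = (j, i) then u else 0)"

text \<open>The Wirtinger derivative \<open>\<partial>/\<partial>Z\<^sub>i\<^sub>j = (\<partial>/\<partial>X\<^sub>i\<^sub>j - i \<partial>/\<partial>Y\<^sub>i\<^sub>j) / 2\<close>, weighted by
  \<open>(1 + \<delta>\<^sub>i\<^sub>j) / 2\<close>.\<close>

definition partial_Z :: "2 \<Rightarrow> 2 \<Rightarrow> (complex^2^2 \<Rightarrow> complex) \<Rightarrow> complex^2^2 \<Rightarrow> complex" where
  "partial_Z i j F Z = (1 + (if i = j then 1 else 0)) / 2 *
     ((dir_deriv (coord_mat i j 1) F Z - \<i> * dir_deriv (coord_mat i j \<i>) F Z) / 2)"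

definition det_partial_Z :: "(complex^2^2 \<Rightarrow> complex) \<Rightarrow> complex^2^2 \<Rightarrow> complex" where
  "det_partial_Z F Z = partial_Z 1 1 (partial_Z 2 2 F) Z - partial_Z 1 2 (partial_Z 2 1 F) Z"

definition maass_op :: "nat \<Rightarrow> (complex^2^2 \<Rightarrow> complex) \<Rightarrow> complex^2^2 \<Rightarrow> complex" where
  "maass_op k h Z = -4 * of_real (det (Im_mat Z) powr (1/2 - real k)) *
     det_partial_Z (\<lambda>W. of_real (det (Im_mat W) powr (real k - 1/2)) * h W) Z"


section \<open>Sturm's operator\<close>

text \<open>The coefficient \<open>A(T,Y)\<close> of \<open>F(Z) = \<Sum>\<^sub>T A(T,Y) exp(2\<pi>i tr(TX))\<close>. Functions of some weight
  for a group containing \<^const>\<open>Gamma_inf\<close> are invariant under translation by integral symmetric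
  matrices, so only half-integral \<open>T\<close> occur.\<close>

definition fourier_coeff ::
    "(complex^2^2 \<Rightarrow> complex) \<Rightarrow> real^2^2 \<Rightarrow> real^2^2 \<Rightarrow> complex" where
  "fourier_coeff F T Y =
     (if half_integral T then
        (LINT x : {0..1} \<times> {0..1} \<times> {0..1} | lborel.
           F (complex_mat (sym_mat x) Y) * exp (- 2 * pi * \<i> * trace (T ** sym_mat x)))
      else 0)"

text \<open>On a holomorphic form \<open>A(T,Y) = a(T) exp(-2\<pi> tr(TY))\<close>, so the normalization requires
  \<open>c(\<kappa>) = \<integral> exp(-4\<pi> tr(TY)) det(TY)\<^bsup>\<kappa>-3/2\<^esup> dY / det(Y)\<^bsup>3/2\<^esup>\<close>. The measure
  \<open>dY / det(Y)\<^bsup>3/2\<^esup>\<close> is invariant under \<open>Y \<mapsto> B Y B'\<close>, so the value does not depend on the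
  positive definite \<open>T\<close>, and we take the unit matrix.\<close>

definition sturm_const :: "nat \<Rightarrow> real" where
  "sturm_const \<kappa> = (LINT y : pos_cone | lborel.
     exp (- 4 * pi * trace (sym_mat y)) * det (sym_mat y) powr (real \<kappa> - 3/2)
       / det (sym_mat y) powr (3/2))"

text \<open>For \<open>s = 0\<close> this is the integrand of Sturm's operator. The factor \<open>det(Y)\<^sup>s\<close> is Hecke's
  convergence factor, see below.\<close>

definition sturm_integrand ::
    "nat \<Rightarrow> (complex^2^2 \<Rightarrow> complex) \<Rightarrow> real^2^2 \<Rightarrow> real \<Rightarrow> real \<times> real \<times> real \<Rightarrow> complex" where
  "sturm_integrand \<kappa> F T s y = (let Y = sym_mat y in
     fourier_coeff F T Y *
     of_real (exp (- 2 * pi * trace (T ** Y)) * det (T ** Y) powr (real \<kappa> - 3/2)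
       * det Y powr s / det Y powr (3/2)))"

definition sturm_converges ::
    "nat \<Rightarrow> (complex^2^2 \<Rightarrow> complex) \<Rightarrow> real^2^2 \<Rightarrow> real \<Rightarrow> bool" where
  "sturm_converges \<kappa> F T s \<longleftrightarrow> set_integrable lborel pos_cone (sturm_integrand \<kappa> F T s)"

definition sturm_coeff ::
    "nat \<Rightarrow> (complex^2^2 \<Rightarrow> complex) \<Rightarrow> real^2^2 \<Rightarrow> real \<Rightarrow> complex" where
  "sturm_coeff \<kappa> F T s =
     inverse (of_real (sturm_const \<kappa>)) * (LINT y : pos_cone | lborel. sturm_integrand \<kappa> F T s y)"

text \<open>In weight \<open>\<kappa> = 3\<close> the integral over the cone need not converge absolutely: if \<open>F\<close> is the
  image under \<^const>\<open>maass_op\<close> of a form of weight 1 whose coefficient at \<open>T\<close> is not 0, then the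
  integrand behaves like \<open>(1/2 - 2\<pi> tr(TY)) exp(-4\<pi> tr(TY)) / det(Y)\<close> at the boundary of the
  cone. Sturm's operator is therefore read as the limit \<open>s \<rightarrow> 0+\<close> of the absolutely convergent
  integrals with the factor \<open>det(Y)\<^sup>s\<close>. Wherever the original integral converges, this is its value
  (lemma \<open>has_sturm_coeff_iff\<close>).\<close>

definition has_sturm_coeff ::
    "nat \<Rightarrow> (complex^2^2 \<Rightarrow> complex) \<Rightarrow> real^2^2 \<Rightarrow> complex \<Rightarrow> bool" where
  "has_sturm_coeff \<kappa> F T a \<longleftrightarrow>
     (\<forall>\<^sub>F s in at_right 0. sturm_converges \<kappa> F T s) \<and>
     (sturm_coeff \<kappa> F T \<longlongrightarrow> a) (at_right 0)"

lemma posdef_det_pos: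
  assumes "posdef Y"
  shows "det Y > 0"
proof -
  have sym: "Y $ 2 $ 1 = Y $ 1 $ 2"
  proof -
    have "transpose Y $ 1 $ 2 = Y $ 1 $ 2"
      using assms by (simp only: posdef_def)
    then show ?thesis by (simp add: transpose_def)
  qed
  have q: "v \<bullet> (Y *v v) > 0" if "v \<noteq> 0" for v
    using assms that by (simp add: posdef_def)
  have "(vector [1, 0] :: real^2) \<noteq> 0"
    by (auto simp: vec_eq_iff intro!: exI[of _ 1])
  from q[OF this] have a: "Y $ 1 $ 1 > 0"
    by (simp add: inner_vec_def matrix_vector_mult_def sum_2)
  have "(vector [- Y $ 1 $ 2, Y $ 1 $ 1] :: real^2) \<noteq> 0"
    using a by (auto simp: vec_eq_iff intro!: exI[of _ 2])
  from q[OF this] have "Y $ 1 $ 1 * det Y > 0"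
    by (simp add: inner_vec_def matrix_vector_mult_def sum_2 det_2 sym algebra_simps)
  then show ?thesis using a by (simp add: zero_less_mult_iff)
qed

lemma has_sturm_coeff_iff:
  assumes conv: "sturm_converges \<kappa> F T 0" and ev: "\<forall>\<^sub>F s in at_right 0. sturm_converges \<kappa> F T s"
  shows "has_sturm_coeff \<kappa> F T a \<longleftrightarrow> a = sturm_coeff \<kappa> F T 0"
proof -
  let ?f = "\<lambda>s y. indicator pos_cone y *\<^sub>R sturm_integrand \<kappa> F T s y"
  let ?d = "\<lambda>y. det (sym_mat y)"
  have pos: "?d y > 0" if "y \<in> pos_cone" for y
    using that posdef_det_pos by (simp add: pos_cone_def)
  have int: "integrable lborel (?f s)" if "sturm_converges \<kappa> F T s" for s
    using that by (simp add: sturm_converges_def set_integrable_def)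
  have f: "?f s y = complex_of_real (?d y powr s) * ?f 0 y" for s y
    using pos[of y] by (cases "y \<in> pos_cone") (auto simp: sturm_integrand_def Let_def)
  have nf: "norm (?f s y) = ?d y powr s * norm (?f 0 y)" for s y
    by (subst f) (simp add: norm_mult)
  obtain s0 where s0: "s0 > 0" "\<And>s. 0 < s \<Longrightarrow> s < s0 \<Longrightarrow> sturm_converges \<kappa> F T s"
    using ev unfolding eventually_at_right_field by auto
  define s1 where "s1 = s0 / 2"
  have s1: "s1 > 0" "s1 < s0" using s0 by (auto simp: s1_def)
  have lim: "(sturm_coeff \<kappa> F T \<longlongrightarrow> sturm_coeff \<kappa> F T 0) (at_right 0)"
  proof (rule tendsto_at_right_sequentially[of 0 s1])
    fix S :: "nat \<Rightarrow> real"
    assume S: "\<And>n. 0 < S n" "\<And>n. S n < s1" "S \<longlonglongrightarrow> 0"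
    have "(\<lambda>n. LINT y | lborel. ?f (S n) y) \<longlonglongrightarrow> (LINT y | lborel. ?f 0 y)"
    proof (rule integral_dominated_convergence)
      show "?f 0 \<in> borel_measurable lborel"
        using int[OF conv] by (rule borel_measurable_integrable)
      show "?f (S n) \<in> borel_measurable lborel" for n
        using int[OF s0(2)[of "S n"]] S(1)[of n] S(2)[of n] s1 by (simp add: borel_measurable_integrable)
      show "integrable lborel (\<lambda>y. norm (?f 0 y) + norm (?f s1 y))"
        using int[OF conv] int[OF s0(2)[OF s1]]
        by (intro Bochner_Integration.integrable_add integrable_norm)
      show "AE y in lborel. (\<lambda>n. ?f (S n) y) \<longlonglongrightarrow> ?f 0 y"
      proof (rule AE_I2)
        fix y
        show "(\<lambda>n. ?f (S n) y) \<longlonglongrightarrow> ?f 0 y"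
        proof (cases "y \<in> pos_cone")
          case True
          have "(\<lambda>n. ?d y powr S n) \<longlonglongrightarrow> ?d y powr 0"
            using pos[OF True] S(3) by (intro tendsto_powr) auto
          then have "(\<lambda>n. complex_of_real (?d y powr S n) * ?f 0 y)
              \<longlonglongrightarrow> complex_of_real (?d y powr 0) * ?f 0 y"
            by (intro tendsto_mult tendsto_of_real tendsto_const)
          then show ?thesis using f[of y, symmetric] by (simp only:)
        qed simp
      qed
      show "AE y in lborel. norm (?f (S n) y) \<le> norm (?f 0 y) + norm (?f s1 y)" for n
      proof (rule AE_I2)
        fix y
        have "?d y powr S n \<le> 1 + ?d y powr s1" if "y \<in> pos_cone"
        proof (cases "?d y \<le> 1")
          case True
          then have "?d y powr S n \<le> 1"
            using S(1)[of n] pos[OF that] by (simp add: powr_le1)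
          then show ?thesis by (simp add: add_increasing2)
        next
          case False
          then have "?d y powr S n \<le> ?d y powr s1"
            using S(2)[of n] by (intro powr_mono) auto
          then show ?thesis by simp
        qed
        then have "?d y powr S n * norm (?f 0 y) \<le> (1 + ?d y powr s1) * norm (?f 0 y)"
          by (cases "y \<in> pos_cone") (simp_all add: mult_right_mono)
        then show "norm (?f (S n) y) \<le> norm (?f 0 y) + norm (?f s1 y)"
          unfolding nf[of y "S n"] nf[of y s1] by (simp add: algebra_simps)
      qed
    qed
    then show "(\<lambda>n. sturm_coeff \<kappa> F T (S n)) \<longlonglongrightarrow> sturm_coeff \<kappa> F T 0"
      unfolding sturm_coeff_def set_lebesgue_integral_def by (intro tendsto_mult tendsto_const)
  qed (use s1 in auto)
  show ?thesis
  proof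
    assume "has_sturm_coeff \<kappa> F T a"
    then have "(sturm_coeff \<kappa> F T \<longlongrightarrow> a) (at_right 0)"
      by (simp only: has_sturm_coeff_def)
    then show "a = sturm_coeff \<kappa> F T 0"
      by (rule tendsto_unique[OF trivial_limit_at_right_real _ lim])
  next
    assume "a = sturm_coeff \<kappa> F T 0"
    then show "has_sturm_coeff \<kappa> F T a"
      using ev lim by (simp only: has_sturm_coeff_def)
  qed
qed

end

theory Submission
  imports Defs "HOL-Probability.Distributions" "HOL-Real_Asymp.Real_Asymp"
begin

text \<open>Differentiating the Fourier expansion of \<open>h\<close> termwise, the \<open>T\<close>-th coefficient of the image of
  \<open>h\<close> under the Maass operator is \<open>c(T) P\<^sub>T(Y) exp(-2\<pi> tr(TY))\<close> with
  \<open>P\<^sub>T(Y) = det(S) - (\<alpha> tr(SY) - \<alpha>(\<alpha> + 1/2)) / det(Y)\<close>, where \<open>S = 4\<pi>T\<close> and \<open>\<alpha> = k - 1/2\<close>.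
  Up to a nonzero factor, Sturm's integral with the factor \<open>det(Y)\<^sup>s\<close> is therefore a combination of the
  integrals \<open>J(\<tau>) = \<integral> exp(-tr(SY)) det(Y)\<^bsup>\<tau>-3/2\<^esup> dY = \<surd>\<pi> \<Gamma>(\<tau>) \<Gamma>(\<tau> - 1/2) det(S)\<^bsup>-\<tau>\<^esup>\<close>; scaling \<open>S\<close>
  shows that an additional factor \<open>tr(SY)\<close> multiplies \<open>J(\<tau>)\<close> by \<open>2\<tau>\<close>. With \<open>\<tau> = \<alpha> + s\<close> the
  combination is \<open>(\<tau>(\<tau> - 1/2) - 2\<alpha>\<tau> + \<alpha>(\<alpha> + 1/2)) J(\<tau>) = s (s - 1/2) J(\<alpha> + s)\<close>. At \<open>s = 0\<close> this
  vanishes for \<open>k \<ge> 2\<close>, whereas for \<open>k = 1\<close> the zero cancels against the pole of \<open>\<Gamma>(s)\<close>.\<close>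

section \<open>Symmetric \<open>2 \<times> 2\<close> matrices\<close>

lemma sym_mat_nth [simp]:
  "sym_mat (a, b, c) $ 1 $ 1 = a" "sym_mat (a, b, c) $ 1 $ 2 = b"
  "sym_mat (a, b, c) $ 2 $ 1 = b" "sym_mat (a, b, c) $ 2 $ 2 = c"
  by (simp_all add: sym_mat_def)

text \<open>Sylvester's criterion in size 2. The vector \<open>(1, 0)\<close> and the determinant
  give the two inequalities; conversely, multiplying the quadratic form by \<open>Y $ 1 $ 1\<close>
  lets one complete the square.\<close>

lemma posdef_iff:
  "posdef Y \<longleftrightarrow> Y $ 2 $ 1 = Y $ 1 $ 2 \<and> 0 < Y $ 1 $ 1 \<and> 0 < Y $ 1 $ 1 * Y $ 2 $ 2 - (Y $ 1 $ 2)\<^sup>2"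
proof
  assume Y: "posdef Y"
  then have "transpose Y $ 1 $ 2 = Y $ 1 $ 2" and q: "\<And>v. v \<noteq> 0 \<Longrightarrow> v \<bullet> (Y *v v) > 0"
    by (simp_all add: posdef_def)
  then have sym: "Y $ 2 $ 1 = Y $ 1 $ 2" by (simp add: transpose_def)
  have "(vector [1, 0] :: real^2) \<noteq> 0"
    by (auto simp: vec_eq_iff intro!: exI[of _ 1])
  from q[OF this] have "Y $ 1 $ 1 > 0"
    by (simp add: inner_vec_def matrix_vector_mult_def sum_2)
  with sym posdef_det_pos[OF Y]
  show "Y $ 2 $ 1 = Y $ 1 $ 2 \<and> 0 < Y $ 1 $ 1 \<and> 0 < Y $ 1 $ 1 * Y $ 2 $ 2 - (Y $ 1 $ 2)\<^sup>2"
    by (simp add: det_2 power2_eq_square)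
next
  assume Y: "Y $ 2 $ 1 = Y $ 1 $ 2 \<and> 0 < Y $ 1 $ 1 \<and> 0 < Y $ 1 $ 1 * Y $ 2 $ 2 - (Y $ 1 $ 2)\<^sup>2"
  show "posdef Y"
    unfolding posdef_def
  proof (intro conjI allI impI)
    show "transpose Y = Y"
      using Y by (simp add: vec_eq_iff forall_2 transpose_def)
    fix v :: "real^2"
    assume v: "v \<noteq> 0"
    have *: "Y $ 1 $ 1 * (v \<bullet> (Y *v v)) = (Y $ 1 $ 1 * v $ 1 + Y $ 1 $ 2 * v $ 2)\<^sup>2
        + (Y $ 1 $ 1 * Y $ 2 $ 2 - (Y $ 1 $ 2)\<^sup>2) * (v $ 2)\<^sup>2"
      using Y by (simp add: inner_vec_def matrix_vector_mult_def sum_2 algebra_simps power2_eq_square)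
    have "0 < Y $ 1 $ 1 * (v \<bullet> (Y *v v))"
    proof (cases "v $ 2 = 0")
      case True
      then have "v $ 1 \<noteq> 0" using v by (auto simp: vec_eq_iff forall_2)
      with True Y show ?thesis unfolding * by simp
    next
      case False
      with Y show ?thesis unfolding * by (intro add_nonneg_pos) auto
    qed
    then show "0 < v \<bullet> (Y *v v)" using Y by (simp add: zero_less_mult_iff)
  qed
qed

lemma trace_mult_2: "trace (A ** B) =
    A $ 1 $ 1 * B $ 1 $ 1 + A $ 1 $ 2 * B $ 2 $ 1 + A $ 2 $ 1 * B $ 1 $ 2 + A $ 2 $ 2 * B $ 2 $ 2"
  for A B :: "'a::comm_semiring_1^2^2"
  by (simp add: trace_def matrix_matrix_mult_def sum_2 algebra_simps)

lemma trace_mult_sym_mat: "trace (T ** sym_mat x) =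
    T $ 1 $ 1 * fst x + (T $ 1 $ 2 + T $ 2 $ 1) * fst (snd x) + T $ 2 $ 2 * snd (snd x)"
  by (cases x) (simp add: trace_mult_2 algebra_simps)

lemma det_sym_mat [simp]: "det (sym_mat (a, b, c)) = a * c - b\<^sup>2"
  by (simp add: det_2 power2_eq_square)

lemma mem_pos_cone_iff: "(a, b, c) \<in> pos_cone \<longleftrightarrow> 0 < a \<and> 0 < a * c - b\<^sup>2"
  by (simp add: pos_cone_def posdef_iff)

text \<open>Only the mixed term \<open>2 * q * b\<close> can be negative. The two determinant
  inequalities multiply to \<open>q^2 * b^2 < (p * r) * (a * c)\<close>, and AM-GM bounds four times
  the right side by \<open>(p * a + r * c)^2\<close>, so the diagonal part wins.\<close>

lemma trace_mult_pos:
  assumes "posdef S" "posdef Y"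
  shows "0 < trace (S ** Y)"
proof -
  define p q r a b c where pqr: "p = S $ 1 $ 1" "q = S $ 1 $ 2" "r = S $ 2 $ 2"
    and abc: "a = Y $ 1 $ 1" "b = Y $ 1 $ 2" "c = Y $ 2 $ 2"
  have S: "S $ 2 $ 1 = q" "0 < p" "0 < p * r - q\<^sup>2" and Y: "Y $ 2 $ 1 = b" "0 < a" "0 < a * c - b\<^sup>2"
    using assms by (simp_all add: posdef_iff pqr abc)
  have "0 < p * r" "0 < a * c"
    using S Y zero_le_power2[of q] zero_le_power2[of b] by linarith+
  then have r: "0 < r" and c: "0 < c"
    using S Y by (simp_all add: zero_less_mult_iff)
  have "q\<^sup>2 * b\<^sup>2 < (p * r) * (a * c)"
    using S Y by (intro mult_strict_mono') auto
  moreover have "4 * ((p * r) * (a * c)) \<le> (p * a + r * c)\<^sup>2"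
    using sum_squares_bound[of "p * a" "r * c"] by (simp add: power2_eq_square algebra_simps)
  ultimately have "(- (2 * q * b))\<^sup>2 < (p * a + r * c)\<^sup>2"
    by (simp add: power_mult_distrib)
  then have "- (2 * q * b) < p * a + r * c"
  proof (rule power2_less_imp_less)
    show "0 \<le> p * a + r * c" using S(2) Y(2) r c by simp
  qed
  moreover have "trace (S ** Y) = p * a + 2 * q * b + r * c"
    by (simp add: trace_mult_2 S(1) Y(1) flip: pqr abc)
  ultimately show ?thesis by simp
qed

lemma trace_scaleR_mult [simp]: "trace ((c *\<^sub>R A) ** B) = c * trace (A ** B)"
  for A B :: "real^2^2"
  by (simp add: trace_mult_2 algebra_simps)

lemma det_scaleR_2 [simp]: "det (c *\<^sub>R A) = c\<^sup>2 * det A" for A :: "real^2^2"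
  by (simp add: det_2 power2_eq_square algebra_simps)

lemma posdef_scaleR: "posdef A \<Longrightarrow> 0 < c \<Longrightarrow> posdef (c *\<^sub>R A)"
  by (simp add: posdef_def scaleR_matrix_vector_assoc[symmetric] transpose_scalar)

section \<open>Integrals over the cone\<close>

lemma nn_integral_exp_powr:
  fixes l x :: real
  assumes "l > 0" "x > 0"
  shows "(\<integral>\<^sup>+t. ennreal (indicator {0<..} t * (exp (- l * t) * t powr (x - 1))) \<partial>lborel)
      = ennreal (Gamma x * l powr - x)"
proof -
  have "ennreal (Gamma x) = (\<integral>\<^sup>+t. ennreal (indicator {0..} t * t powr (x - 1) / exp t) \<partial>lborel)"
    using nn_integral_has_integral_lebesgue[OF _ Gamma_integral_real[OF assms(2)]] by simp
  also have "\<dots> = ennreal l * (\<integral>\<^sup>+t. ennreal (indicator {0..} (l * t) * (l * t) powr (x - 1) / exp (l * t)) \<partial>lborel)"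
    using assms by (subst nn_integral_real_affine[where t = 0 and c = l]) auto
  also have "\<dots> = (\<integral>\<^sup>+t. ennreal l * ennreal (indicator {0..} (l * t) * (l * t) powr (x - 1) / exp (l * t)) \<partial>lborel)"
    by (subst nn_integral_cmult) auto
  also have "\<dots> = (\<integral>\<^sup>+t. ennreal (l powr x) * ennreal (indicator {0<..} t * (exp (- l * t) * t powr (x - 1))) \<partial>lborel)"
  proof (rule nn_integral_cong)
    \<comment> \<open>At \<open>t = 0\<close> both integrands vanish, because
      \<open>0 powr _\<close> is 0; so replacing \<open>{0..}\<close> by \<open>{0<..}\<close> is
      correct pointwise.\<close>
    fix t :: real
    have "l * (l * t) powr (x - 1) = l powr x * t powr (x - 1)" if "t > 0"
      using assms that by (simp add: powr_mult powr_diff field_simps)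
    then show "ennreal l * ennreal (indicator {0..} (l * t) * (l * t) powr (x - 1) / exp (l * t))
      = ennreal (l powr x) * ennreal (indicator {0<..} t * (exp (- l * t) * t powr (x - 1)))"
      using assms by (auto simp: indicator_def ennreal_mult[symmetric] zero_le_mult_iff exp_minus field_simps
        split: if_splits intro!: arg_cong[where f = ennreal])
  qed
  also have "\<dots> = ennreal (l powr x) * (\<integral>\<^sup>+t. ennreal (indicator {0<..} t * (exp (- l * t) * t powr (x - 1))) \<partial>lborel)"
    by (subst nn_integral_cmult) auto
  finally have "ennreal (l powr x) * (\<integral>\<^sup>+t. ennreal (indicator {0<..} t * (exp (- l * t) * t powr (x - 1))) \<partial>lborel) = ennreal (Gamma x)" by simp
  then have "ennreal (l powr -x) * (ennreal (l powr x) * (\<integral>\<^sup>+t. ennreal (indicator {0<..} t * (exp (- l * t) * t powr (x - 1))) \<partial>lborel))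
     = ennreal (Gamma x * l powr - x)"
    using assms by (simp add: ennreal_mult[symmetric] mult.commute)
  then show ?thesis
    using assms by (simp add: mult.assoc[symmetric] ennreal_mult[symmetric] powr_add[symmetric])
qed

lemma nn_integral_gauss:
  fixes l m :: real
  assumes "l > 0"
  shows "(\<integral>\<^sup>+t. ennreal (exp (- l * (t + m)\<^sup>2)) \<partial>lborel) = ennreal (sqrt (pi / l))"
proof -
  \<comment> \<open>The normal density has exponent \<open>- (t + m)^2 / (2 * s^2)\<close>; this
    \<open>s\<close> makes \<open>2 * s^2\<close> equal to \<open>1 / l\<close>.\<close>
  define s where "s = 1 / sqrt (2 * l)"
  have s: "s > 0" "s\<^sup>2 = 1 / (2 * l)" using assms by (simp_all add: s_def power_divide)
  interpret prob_space "density lborel (normal_density (- m) s)"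
    by (rule prob_space_normal_density[OF s(1)])
  have "(\<integral>\<^sup>+t. ennreal (normal_density (-m) s t) \<partial>lborel) = 1"
    using emeasure_space_1 by (simp add: emeasure_density)
  moreover have "normal_density (-m) s t = exp (- l * (t + m)\<^sup>2) / sqrt (pi / l)" for t
    using assms by (simp add: normal_density_def s)
  ultimately have "(\<integral>\<^sup>+t. ennreal (exp (- l * (t + m)\<^sup>2) / sqrt (pi / l)) \<partial>lborel) = 1" by simp
  then have "ennreal (sqrt (pi / l)) * (\<integral>\<^sup>+t. ennreal (exp (- l * (t + m)\<^sup>2) / sqrt (pi / l)) \<partial>lborel) = ennreal (sqrt (pi / l))"
    by simp
  then show ?thesis
    using assms by (simp add: nn_integral_cmult[symmetric] ennreal_mult[symmetric])
qed

lemma nn_integral_lborel_triple: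
  fixes f :: "real \<times> real \<times> real \<Rightarrow> ennreal"
  assumes [measurable]: "f \<in> borel_measurable borel"
  shows "(\<integral>\<^sup>+y. f y \<partial>lborel) = (\<integral>\<^sup>+a. \<integral>\<^sup>+b. \<integral>\<^sup>+c. f (a, b, c) \<partial>lborel \<partial>lborel \<partial>lborel)"
proof -
  have "(\<integral>\<^sup>+y. f y \<partial>lborel) = (\<integral>\<^sup>+a. \<integral>\<^sup>+bc. f (a, bc) \<partial>(lborel :: (real \<times> real) measure) \<partial>lborel)"
    by (simp only: lborel_prod[symmetric, where ?'b = "real \<times> real"])
       (subst lborel.nn_integral_fst[symmetric], auto simp: lborel_prod)
  also have "\<dots> = (\<integral>\<^sup>+a. \<integral>\<^sup>+b. \<integral>\<^sup>+c. f (a, b, c) \<partial>lborel \<partial>lborel \<partial>lborel)"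
    by (simp only: lborel_prod[symmetric, where ?'b = real])
       (subst lborel.nn_integral_fst[symmetric], auto simp: lborel_prod)
  finally show ?thesis .
qed

text \<open>The integrations run over \<open>c\<close>, \<open>b\<close>, \<open>a\<close> in this
  order. Shifting \<open>c\<close> by \<open>b^2 / a\<close> turns the determinant into
  \<open>a * c\<close> and allows a square in \<open>b\<close> to be completed. There remain a Gamma
  integral in \<open>c\<close>, a Gaussian in \<open>b\<close> and a Gamma integral in
  \<open>a\<close>. With nonnegative integrals Tonelli applies before integrability is
  known.\<close>

lemma nn_integral_pos_cone:
  fixes p q r \<tau> :: real
  assumes p: "p > 0" and D: "p * r - q\<^sup>2 > 0" and \<tau>: "\<tau> > 1/2"
  shows "(\<integral>\<^sup>+y. ennreal (case y of (a, b, c) \<Rightarrow> if 0 < a \<and> 0 < a * c - b\<^sup>2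
            then exp (- (p * a + 2 * q * b + r * c)) * (a * c - b\<^sup>2) powr (\<tau> - 3/2) else 0) \<partial>lborel)
       = ennreal (sqrt pi * Gamma \<tau> * Gamma (\<tau> - 1/2) * (p * r - q\<^sup>2) powr - \<tau>)"
proof -
  define f where "f a b c = (if 0 < a \<and> 0 < a * c - b\<^sup>2
    then exp (- (p * a + 2 * q * b + r * c)) * (a * c - b\<^sup>2) powr (\<tau> - 3/2) else 0)" for a b c
  have r: "r > 0"
  proof -
    have "0 < p * r" using D zero_le_power2[of q] by linarith
    then show ?thesis using p by (simp add: zero_less_mult_iff)
  qed
  have m: "(\<lambda>y. ennreal (case y of (a, b, c) \<Rightarrow> f a b c)) \<in> borel_measurable borel"
    by (simp add: f_def case_prod_beta borel_prod[symmetric]) measurable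
  define G where "G = Gamma (\<tau> - 1/2) * r powr (1/2 - \<tau>)"
  have G: "G > 0" using \<tau> r by (simp add: G_def Gamma_real_pos)
  \<comment> \<open>The Schur complement of \<open>r\<close>: the rate of decay in \<open>a\<close>
    that is left once the square in \<open>b\<close> has been split off.\<close>
  define D' where "D' = p - q\<^sup>2 / r"
  have D': "D' > 0" "D' = (p * r - q\<^sup>2) / r" using D r by (simp_all add: D'_def field_simps)
  have 1: "(\<integral>\<^sup>+c. ennreal (f a b c) \<partial>lborel) =
      ennreal (G * a powr (\<tau> - 3/2) * exp (- D' * a)) * ennreal (exp (- (r / a) * (b + q * a / r)\<^sup>2))"
    if a: "a > 0" for a b
  proof -
    have "(\<integral>\<^sup>+c. ennreal (f a b c) \<partial>lborel) = (\<integral>\<^sup>+c. ennreal (f a b (b\<^sup>2 / a + 1 * c)) \<partial>lborel)"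
      by (subst nn_integral_real_affine[where t = "b\<^sup>2 / a" and c = 1]) (auto simp: f_def)
    also have "\<dots> = (\<integral>\<^sup>+c. ennreal (exp (- (r / a) * (b + q * a / r)\<^sup>2) * exp (- D' * a) * a powr (\<tau> - 3/2)) *
        ennreal (indicator {0<..} c * (exp (- r * c) * c powr (\<tau> - 1/2 - 1))) \<partial>lborel)"
    proof (rule nn_integral_cong)
      fix c :: real
      have e: "a * (b\<^sup>2 / a + 1 * c) - b\<^sup>2 = a * c" using a by (simp add: field_simps)
      have e2: "- (p * a + 2 * q * b + r * (b\<^sup>2 / a + 1 * c)) = - (r / a) * (b + q * a / r)\<^sup>2 + (- D' * a + - r * c)"
        using a r by (simp add: D'_def field_simps power2_eq_square)
      have pe: "(a * c) powr (\<tau> - 3/2) = a powr (\<tau> - 3/2) * c powr (\<tau> - 1/2 - 1)" if "c > 0"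
        using a that by (simp add: powr_mult)
      show "ennreal (f a b (b\<^sup>2 / a + 1 * c)) =
        ennreal (exp (- (r / a) * (b + q * a / r)\<^sup>2) * exp (- D' * a) * a powr (\<tau> - 3/2)) *
        ennreal (indicator {0<..} c * (exp (- r * c) * c powr (\<tau> - 1/2 - 1)))"
      proof (cases "c > 0")
        case True
        then show ?thesis
          unfolding f_def e e2 exp_add using a
          by (simp add: ennreal_mult[symmetric] pe mult_ac)
      next
        case False
        then have "\<not> 0 < a * c" using a by (simp add: zero_less_mult_iff)
        with False show ?thesis unfolding f_def e by simp
      qed
    qed
    also have "\<dots> = ennreal (exp (- (r / a) * (b + q * a / r)\<^sup>2) * exp (- D' * a) * a powr (\<tau> - 3/2)) *
        ennreal G"
      unfolding G_def using r \<tau> by (subst nn_integral_cmult, measurable) (subst nn_integral_exp_powr, auto)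
    also have "\<dots> = ennreal (G * a powr (\<tau> - 3/2) * exp (- D' * a)) * ennreal (exp (- (r / a) * (b + q * a / r)\<^sup>2))"
      using G by (simp add: ennreal_mult[symmetric] mult_ac)
    finally show ?thesis .
  qed
  have 2: "(\<integral>\<^sup>+b. \<integral>\<^sup>+c. ennreal (f a b c) \<partial>lborel \<partial>lborel) =
      ennreal (G * sqrt (pi / r)) * ennreal (indicator {0<..} a * (exp (- D' * a) * a powr (\<tau> - 1)))" for a
  proof (cases "a > 0")
    case True
    have "(\<integral>\<^sup>+b. \<integral>\<^sup>+c. ennreal (f a b c) \<partial>lborel \<partial>lborel) =
       ennreal (G * a powr (\<tau> - 3/2) * exp (- D' * a)) * ennreal (sqrt (pi / (r / a)))"
      using True r by (simp only: 1[OF True])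
        (subst nn_integral_cmult, auto simp only: nn_integral_gauss divide_pos_pos, auto)
    \<comment> \<open>The width of the Gaussian depends on \<open>a\<close>, which raises the
      exponent of \<open>a\<close> from \<open>\<tau> - 3/2\<close> to
      \<open>\<tau> - 1\<close>.\<close>
    also have "sqrt (pi / (r / a)) = sqrt (pi / r) * a powr (1/2)"
      using True by (simp add: powr_half_sqrt real_sqrt_mult[symmetric])
    also have "ennreal (G * a powr (\<tau> - 3/2) * exp (- D' * a)) * ennreal (sqrt (pi / r) * a powr (1/2)) =
      ennreal ((G * sqrt (pi / r)) * (exp (- D' * a) * (a powr (\<tau> - 3/2) * a powr (1/2))))"
      using G r by (simp add: ennreal_mult[symmetric] mult_ac)
    also have "a powr (\<tau> - 3/2) * a powr (1/2) = a powr (\<tau> - 1)"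
      by (simp add: powr_add[symmetric])
    finally show ?thesis using True G r by (simp add: ennreal_mult)
  qed (simp add: f_def)
  have "(\<integral>\<^sup>+y. ennreal (case y of (a, b, c) \<Rightarrow> f a b c) \<partial>lborel) =
     (\<integral>\<^sup>+a. ennreal (G * sqrt (pi / r)) * ennreal (indicator {0<..} a * (exp (- D' * a) * a powr (\<tau> - 1))) \<partial>lborel)"
    by (simp only: nn_integral_lborel_triple[OF m] prod.case 2)
  also have "\<dots> = ennreal (G * sqrt (pi / r)) * ennreal (Gamma \<tau> * D' powr - \<tau>)"
    using D' \<tau> by (subst nn_integral_cmult, measurable) (subst nn_integral_exp_powr, auto)
  also have "\<dots> = ennreal (G * sqrt (pi / r) * (Gamma \<tau> * D' powr - \<tau>))"
    using G r by (simp add: ennreal_mult')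
  also have "G * sqrt (pi / r) * (Gamma \<tau> * D' powr - \<tau>) =
     sqrt pi * Gamma \<tau> * Gamma (\<tau> - 1/2) * (p * r - q\<^sup>2) powr - \<tau>"
  proof -
    have "D' powr - \<tau> = (p * r - q\<^sup>2) powr - \<tau> * r powr \<tau>"
      unfolding D'(2) using r D by (simp add: powr_divide powr_minus field_simps)
    moreover have "r powr (1/2 - \<tau>) * r powr \<tau> = sqrt r"
      using r by (simp add: powr_add[symmetric] powr_half_sqrt)
    ultimately show ?thesis using r
      by (simp add: G_def real_sqrt_divide field_simps)
  qed
  finally show ?thesis by (simp only: f_def)
qed

text \<open>Siegel's gamma function of the cone of positive definite matrices of size 2; for
  \<open>\<tau> > 1/2\<close> it is the integral over the cone at the unit matrix.\<close>

definition cone_gamma :: "real \<Rightarrow> real" where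
  "cone_gamma \<tau> = sqrt pi * Gamma \<tau> * Gamma (\<tau> - 1/2)"

lemma cone_gamma_plus1:
  assumes "\<tau> > 1/2"
  shows "cone_gamma (\<tau> + 1) = \<tau> * (\<tau> - 1/2) * cone_gamma \<tau>"
proof -
  have "\<tau> \<notin> \<int>\<^sub>\<le>\<^sub>0" "\<tau> - 1/2 \<notin> \<int>\<^sub>\<le>\<^sub>0"
    using assms by (auto simp: nonpos_Ints_def)
  then have "Gamma (\<tau> + 1) = \<tau> * Gamma \<tau>" "Gamma (\<tau> + 1 - 1/2) = (\<tau> - 1/2) * Gamma (\<tau> - 1/2)"
    using Gamma_plus1[of \<tau>] Gamma_plus1[of "\<tau> - 1/2"] by (simp_all add: algebra_simps)
  then show ?thesis by (simp only: cone_gamma_def mult_ac)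
qed

lemma has_bochner_integral_pos_cone:
  assumes S: "posdef S" and \<tau>: "\<tau> > 1/2"
  shows "has_bochner_integral lborel
    (\<lambda>y. indicator pos_cone y *\<^sub>R (exp (- trace (S ** sym_mat y)) * det (sym_mat y) powr (\<tau> - 3/2)))
    (cone_gamma \<tau> * det S powr - \<tau>)"
proof -
  define p q r where pqr: "p = S $ 1 $ 1" "q = S $ 1 $ 2" "r = S $ 2 $ 2"
  have S': "S $ 2 $ 1 = q" "0 < p" "0 < p * r - q\<^sup>2"
    using S by (simp_all add: posdef_iff pqr)
  have det: "det S = p * r - q\<^sup>2"
    using S' by (simp add: det_2 pqr power2_eq_square)
  have eq: "(\<lambda>y. indicator pos_cone y *\<^sub>R (exp (- trace (S ** sym_mat y)) * det (sym_mat y) powr (\<tau> - 3/2)))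
    = (\<lambda>y. case y of (a, b, c) \<Rightarrow> if 0 < a \<and> 0 < a * c - b\<^sup>2
            then exp (- (p * a + 2 * q * b + r * c)) * (a * c - b\<^sup>2) powr (\<tau> - 3/2) else 0)"
    by (auto simp: mem_pos_cone_iff trace_mult_2 S' pqr[symmetric] indicator_def fun_eq_iff)
  show ?thesis
    unfolding eq
  proof (rule has_bochner_integral_nn_integral)
    show "(\<lambda>y. case y of (a, b, c) \<Rightarrow> if 0 < a \<and> 0 < a * c - b\<^sup>2
            then exp (- (p * a + 2 * q * b + r * c)) * (a * c - b\<^sup>2) powr (\<tau> - 3/2) else 0)
        \<in> borel_measurable lborel"
      by (simp add: case_prod_beta borel_prod[symmetric]) measurable
    show "0 \<le> cone_gamma \<tau> * det S powr - \<tau>"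
      using \<tau> by (simp add: cone_gamma_def Gamma_real_pos less_imp_le)
    show "(\<integral>\<^sup>+y. ennreal (case y of (a, b, c) \<Rightarrow> if 0 < a \<and> 0 < a * c - b\<^sup>2
            then exp (- (p * a + 2 * q * b + r * c)) * (a * c - b\<^sup>2) powr (\<tau> - 3/2) else 0) \<partial>lborel)
        = ennreal (cone_gamma \<tau> * det S powr - \<tau>)"
      unfolding cone_gamma_def det by (rule nn_integral_pos_cone) (use S' \<tau> in auto)
  qed auto
qed

text \<open>Replacing \<open>S\<close> by \<open>l *\<^sub>R S\<close> multiplies the previous
  integral by \<open>l powr (- 2 * \<tau>)\<close>; minus the derivative at \<open>l = 1\<close>
  produces the trace under the integral and the factor \<open>2 * \<tau>\<close> outside. The
  derivative is taken along the sequence \<open>1 + 1 / Suc n\<close>, so that dominated convergence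
  suffices.\<close>

lemma has_bochner_integral_pos_cone_trace:
  assumes S: "posdef S" and \<tau>: "\<tau> > 1/2"
  shows "has_bochner_integral lborel
    (\<lambda>y. indicator pos_cone y *\<^sub>R (trace (S ** sym_mat y) *
       (exp (- trace (S ** sym_mat y)) * det (sym_mat y) powr (\<tau> - 3/2))))
    (2 * \<tau> * (cone_gamma \<tau> * det S powr - \<tau>))"
proof -
  define C where "C = cone_gamma \<tau> * det S powr - \<tau>"
  define G where "G l y = indicator pos_cone y *\<^sub>R
    (exp (- (l * trace (S ** sym_mat y))) * det (sym_mat y) powr (\<tau> - 3/2))" for l :: real and y
  have G: "has_bochner_integral lborel (G l) (C * l powr (- 2 * \<tau>))" if "l > 0" for l
  proof -
    have "det (l *\<^sub>R S) powr - \<tau> = det S powr - \<tau> * l powr (- 2 * \<tau>)"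
      using that posdef_det_pos[OF S] powr_powr[of l 2 "- \<tau>"] by (simp add: powr_mult)
    then show ?thesis
      using has_bochner_integral_pos_cone[OF posdef_scaleR[OF S that] \<tau>]
      by (simp add: G_def[abs_def] C_def mult_ac)
  qed
  \<comment> \<open>The difference quotient of \<open>- G l y\<close> at \<open>l = 1\<close> with
    increment \<open>1 / Suc n\<close>.\<close>
  define s where "s n y = real (Suc n) * (G 1 y - G (1 + 1 / real (Suc n)) y)" for n y
  define f where "f y = indicator pos_cone y *\<^sub>R (trace (S ** sym_mat y) *
       (exp (- trace (S ** sym_mat y)) * det (sym_mat y) powr (\<tau> - 3/2)))" for y
  have s: "has_bochner_integral lborel (s n) (real (Suc n) * (C - C * (1 + 1 / real (Suc n)) powr (- 2 * \<tau>)))" for n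
    using G[of 1] G[of "1 + 1 / real (Suc n)"] unfolding s_def
    by (intro has_bochner_integral_mult_right has_bochner_integral_diff) (auto simp: add_pos_nonneg)
  have pt: "(\<lambda>n. s n y) \<longlonglongrightarrow> f y" for y
  proof (cases "y \<in> pos_cone")
    case True
    define x where "x = trace (S ** sym_mat y)"
    have "x > 0" using True S by (simp add: x_def pos_cone_def trace_mult_pos)
    then have "(\<lambda>n. real (Suc n) * (exp (- x) - exp (- ((1 + 1 / real (Suc n)) * x)))) \<longlonglongrightarrow> x * exp (- x)"
      by real_asymp
    from tendsto_mult_right[OF this, of "det (sym_mat y) powr (\<tau> - 3/2)"] show ?thesis
      using True by (simp add: s_def f_def G_def x_def algebra_simps)
  qed (simp add: s_def f_def G_def)
  \<comment> \<open>From \<open>1 - exp (- u) \<le> u\<close> the quotient is at most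
    \<open>x * exp (- x)\<close>, and \<open>x \<le> 2 * exp (x / 2)\<close> trades the factor
    \<open>x\<close> for half of the decay. The majorant is again an integral of known
    value.\<close>
  have bd: "norm (s n y) \<le> 2 * G (1/2) y" for n y
  proof (cases "y \<in> pos_cone")
    case True
    define x where "x = trace (S ** sym_mat y)"
    have x: "x > 0" using True S by (simp add: x_def pos_cone_def trace_mult_pos)
    let ?n = "real (Suc n)"
    have "exp (- ((1 + 1 / ?n) * x)) = exp (- x) * exp (- (x / ?n))"
      by (simp add: exp_add[symmetric] algebra_simps)
    then have factor: "?n * (exp (- x) - exp (- ((1 + 1 / ?n) * x))) = exp (- x) * (?n * (1 - exp (- (x / ?n))))"
      by (simp add: algebra_simps)
    also have "\<dots> \<le> exp (- x) * (?n * (x / ?n))"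
      using exp_ge_add_one_self[of "- (x / ?n)"] by (intro mult_left_mono) auto
    also have "\<dots> = exp (- x) * x" by simp
    also have "\<dots> \<le> exp (- x) * (2 * exp (x / 2))"
      using exp_ge_add_one_self[of "x / 2"] by (intro mult_left_mono exp_ge_zero) linarith
    also have "\<dots> = 2 * exp (- (1/2 * x))"
      by (simp add: exp_add[symmetric])
    finally have *: "?n * (exp (- x) - exp (- ((1 + 1 / ?n) * x))) \<le> 2 * exp (- (1/2 * x))" .
    have "0 \<le> ?n * (exp (- x) - exp (- ((1 + 1 / ?n) * x)))"
      unfolding factor using x by (intro mult_nonneg_nonneg) auto
    with * have "\<bar>?n * (exp (- x) - exp (- ((1 + 1 / ?n) * x)))\<bar> \<le> 2 * exp (- (1/2 * x))" by simp
    from mult_right_mono[OF this, of "det (sym_mat y) powr (\<tau> - 3/2)"] show ?thesis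
      using True unfolding s_def G_def x_def[symmetric]
      by (simp add: left_diff_distrib[symmetric] abs_mult mult_ac)
  qed (simp add: s_def f_def G_def)
  have sm: "s n \<in> borel_measurable lborel" for n
    using s[of n] by (auto simp: has_bochner_integral_iff)
  then have fm: "f \<in> borel_measurable lborel"
    by (rule borel_measurable_LIMSEQ_metric) (use pt in auto)
  have w: "integrable lborel (\<lambda>y. 2 * G (1/2) y)"
    using G[of "1/2"] by (simp add: has_bochner_integral_iff)
  have "integrable lborel f"
    by (rule integrable_dominated_convergence[where s = s, OF fm sm w]) (use pt bd in auto)
  moreover have "(\<lambda>n. integral\<^sup>L lborel (s n)) \<longlonglongrightarrow> integral\<^sup>L lborel f"
    by (rule integral_dominated_convergence[where s = s, OF fm sm w]) (use pt bd in auto)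
  moreover have "(\<lambda>n. integral\<^sup>L lborel (s n)) \<longlonglongrightarrow> 2 * \<tau> * C"
  proof -
    have "(\<lambda>n. real (Suc n) * (C - C * (1 + 1 / real (Suc n)) powr (- 2 * \<tau>))) \<longlonglongrightarrow> 2 * \<tau> * C"
      using \<tau> by real_asymp
    then show ?thesis using s by (simp only: has_bochner_integral_iff)
  qed
  ultimately show ?thesis
    unfolding f_def[symmetric] C_def[symmetric] has_bochner_integral_iff
    using LIMSEQ_unique by blast
qed

text \<open>Dividing by \<open>det (sym_mat y)\<close> lowers the exponent by one, so the integrand
  splits into the two kinds of integrals above at \<open>\<tau>\<close> and
  \<open>\<tau> + 1\<close>. For \<open>\<alpha> = k - 1/2\<close> the hypothesis at
  \<open>s = 0\<close> says \<open>k > 1\<close>: this is where weight at least 4 separates from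
  weight 3.\<close>

lemma has_bochner_integral_pos_cone_maass:
  assumes S: "posdef S" and s: "\<alpha> + s > 1/2"
  shows "has_bochner_integral lborel
    (\<lambda>y. indicator pos_cone y *\<^sub>R
      ((det S - (\<alpha> * trace (S ** sym_mat y) - \<alpha> * (\<alpha> + 1/2)) / det (sym_mat y)) *
       (exp (- trace (S ** sym_mat y)) * det (sym_mat y) powr (\<alpha> + s - 1/2))))
    (s * (s - 1/2) * (cone_gamma (\<alpha> + s) * det S powr - (\<alpha> + s)))"
proof -
  define \<tau> where "\<tau> = \<alpha> + s"
  have \<tau>: "\<tau> > 1/2" using s by (simp add: \<tau>_def)
  define E where "E t y = exp (- trace (S ** sym_mat y)) * det (sym_mat y) powr (t - 3/2)" for t y
  have D: "det S > 0" using S by (rule posdef_det_pos)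
  have "has_bochner_integral lborel
    (\<lambda>y. det S * (indicator pos_cone y *\<^sub>R E (\<tau> + 1) y)
       - \<alpha> * (indicator pos_cone y *\<^sub>R (trace (S ** sym_mat y) * E \<tau> y))
       + \<alpha> * (\<alpha> + 1/2) * (indicator pos_cone y *\<^sub>R E \<tau> y))
    (det S * (cone_gamma (\<tau> + 1) * det S powr - (\<tau> + 1))
       - \<alpha> * (2 * \<tau> * (cone_gamma \<tau> * det S powr - \<tau>))
       + \<alpha> * (\<alpha> + 1/2) * (cone_gamma \<tau> * det S powr - \<tau>))"
    unfolding E_def using \<tau>
    by (intro has_bochner_integral_add has_bochner_integral_diff has_bochner_integral_mult_right
        has_bochner_integral_pos_cone[OF S] has_bochner_integral_pos_cone_trace[OF S]) auto
  moreover have "det S * (cone_gamma (\<tau> + 1) * det S powr - (\<tau> + 1))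
       - \<alpha> * (2 * \<tau> * (cone_gamma \<tau> * det S powr - \<tau>))
       + \<alpha> * (\<alpha> + 1/2) * (cone_gamma \<tau> * det S powr - \<tau>) = s * (s - 1/2) * (cone_gamma \<tau> * det S powr - \<tau>)"
  proof -
    have "det S * det S powr - (\<tau> + 1) = det S powr - \<tau>"
      using D by (simp add: powr_diff)
    then have "det S * (cone_gamma (\<tau> + 1) * det S powr - (\<tau> + 1)) = \<tau> * (\<tau> - 1/2) * (cone_gamma \<tau> * det S powr - \<tau>)"
      using cone_gamma_plus1[OF \<tau>] by (simp add: mult_ac)
    moreover have "\<tau> * (\<tau> - 1/2) * C - \<alpha> * (2 * \<tau> * C) + \<alpha> * (\<alpha> + 1/2) * C = s * (s - 1/2) * C" for C
      by (simp add: \<tau>_def algebra_simps)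
    ultimately show ?thesis by simp
  qed
  moreover have "det S * (indicator pos_cone y *\<^sub>R E (\<tau> + 1) y)
       - \<alpha> * (indicator pos_cone y *\<^sub>R (trace (S ** sym_mat y) * E \<tau> y))
       + \<alpha> * (\<alpha> + 1/2) * (indicator pos_cone y *\<^sub>R E \<tau> y)
     = indicator pos_cone y *\<^sub>R
      ((det S - (\<alpha> * trace (S ** sym_mat y) - \<alpha> * (\<alpha> + 1/2)) / det (sym_mat y)) *
       (exp (- trace (S ** sym_mat y)) * det (sym_mat y) powr (\<tau> - 1/2)))" for y
  proof (cases "y \<in> pos_cone")
    case True
    then have d: "det (sym_mat y) > 0" by (simp add: pos_cone_def posdef_det_pos)
    define P where "P = exp (- trace (S ** sym_mat y)) * det (sym_mat y) powr (\<tau> - 1/2)"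
    have E: "E \<tau> y = P / det (sym_mat y)" "E (\<tau> + 1) y = P"
      using d powr_diff[of "det (sym_mat y)" "\<tau> - 1/2" 1] by (simp_all add: E_def P_def)
    then show ?thesis
      unfolding P_def[symmetric] E using True d by (simp add: field_simps)
  qed simp
  ultimately show ?thesis by (simp only: \<tau>_def)
qed

text \<open>In weight 3 one has \<open>\<alpha> = 1/2\<close>, and the second Gamma factor becomes
  \<open>Gamma s\<close>. Its pole is removed by \<open>s * Gamma s = Gamma (s + 1)\<close>, and
  \<open>Gamma (1/2) = sqrt pi\<close> gives the limit.\<close>

lemma tendsto_cone_gamma_pole:
  "((\<lambda>s. s * cone_gamma (1/2 + s)) \<longlongrightarrow> pi) (at_right 0)"
proof -
  have "((\<lambda>s. sqrt pi * Gamma (1/2 + s) * Gamma (s + 1)) \<longlongrightarrow> sqrt pi * Gamma (1/2 + 0) * Gamma (0 + 1)) (at_right (0::real))"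
    by (intro tendsto_intros) (auto elim!: nonpos_Ints_cases)
  moreover have "sqrt pi * Gamma (1/2 + 0) * Gamma (0 + 1) = pi"
    by (simp add: Gamma_one_half_real)
  moreover have "\<forall>\<^sub>F s in at_right 0. sqrt pi * Gamma (1/2 + s) * Gamma (s + 1) = s * cone_gamma (1/2 + s)"
    using eventually_at_right_less[of 0]
  proof eventually_elim
    case (elim s)
    then have "Gamma (s + 1) = s * Gamma s"
      by (intro Gamma_plus1) (auto simp: nonpos_Ints_def)
    then show ?case by (simp add: cone_gamma_def)
  qed
  ultimately show ?thesis
    by (auto elim: Lim_transform_eventually)
qed

section \<open>Fourier series on the Siegel upper half space\<close>

lemma has_sum_diff:
  fixes f g :: "'a \<Rightarrow> 'b::topological_ab_group_add"
  assumes "(f has_sum a) A" "(g has_sum b) A"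
  shows "((\<lambda>x. f x - g x) has_sum (a - b)) A"
  using has_sum_add[OF assms(1), of "\<lambda>x. - g x" "- b"] assms(2) by (simp add: has_sum_uminus)

text \<open>The second order Taylor remainder of each term is at most \<open>t^2\<close> times a
  constant times the summable majorant, so the remainder of the sum is
  O(\<open>t^2\<close>).\<close>

lemma has_vector_derivative_infsum_exp:
  fixes a b :: "'a \<Rightarrow> complex"
  assumes \<eta>: "\<eta> > 0" and sm: "(\<lambda>x. norm (a x) * exp (\<eta> * norm (b x))) summable_on A"
  shows "((\<lambda>t::real. \<Sum>\<^sub>\<infinity>x\<in>A. a x * exp (t *\<^sub>R b x)) has_vector_derivative (\<Sum>\<^sub>\<infinity>x\<in>A. a x * b x)) (at 0)"
proof -
  define M where "M x = norm (a x) * exp (\<eta> * norm (b x))" for x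
  define C where "C = (\<Sum>\<^sub>\<infinity>x\<in>A. M x)"
  have M: "M summable_on A" using sm by (simp add: M_def[abs_def])
  have summ: "f summable_on A" if "\<And>x. norm (f x) \<le> B * M x" for f :: "'a \<Rightarrow> complex" and B
    by (rule abs_summable_summable, rule Infinite_Sum.abs_summable_on_comparison_test'[OF summable_on_cmult_right[OF M, of B]])
       (use that in auto)
  have a_exp: "(\<lambda>x. a x * exp (t *\<^sub>R b x)) summable_on A" if "\<bar>t\<bar> \<le> \<eta>" for t
  proof (rule summ[of _ 1])
    fix x
    have "norm (exp (t *\<^sub>R b x)) \<le> exp (norm (t *\<^sub>R b x))" by (rule norm_exp)
    also have "\<dots> \<le> exp (\<eta> * norm (b x))" using that by (simp add: mult_right_mono)
    finally show "norm (a x * exp (t *\<^sub>R b x)) \<le> 1 * M x"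
      by (simp add: M_def norm_mult mult_left_mono)
  qed
  have ab: "(\<lambda>x. a x * b x) summable_on A"
  proof (rule summ[of _ "1 / \<eta>"])
    fix x
    have "\<eta> * norm (b x) \<le> exp (\<eta> * norm (b x))"
      using exp_ge_add_one_self[of "\<eta> * norm (b x)"] by linarith
    then have "norm (a x) * (\<eta> * norm (b x)) \<le> M x"
      unfolding M_def by (rule mult_left_mono) simp
    then show "norm (a x * b x) \<le> 1 / \<eta> * M x"
      using \<eta> by (simp add: norm_mult field_simps)
  qed
  have rem: "norm (a x * exp (t *\<^sub>R b x) - a x - t *\<^sub>R (a x * b x)) \<le> t\<^sup>2 * (8 / \<eta>\<^sup>2) * M x"
    if t: "\<bar>t\<bar> \<le> \<eta> / 2" for t x
  proof -
    \<comment> \<open>For \<open>\<bar>t\<bar> \<le> \<eta> / 2\<close> one half of the majorant's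
      exponent, \<open>exp y\<close>, bounds the exponential in Taylor's remainder. The other half
      absorbs the square of \<open>norm (b x)\<close> through \<open>y^2 / 2 \<le> exp y\<close>;
      the constant \<open>8 / \<eta>^2\<close> comes from
      \<open>norm (b x)^2 = (8 / \<eta>^2) * (y^2 / 2)\<close>.\<close>
    define y where "y = \<eta> * norm (b x) / 2"
    have y: "0 \<le> y" using \<eta> by (simp add: y_def)
    have "norm (exp (t *\<^sub>R b x) - (\<Sum>k\<le>1. (t *\<^sub>R b x) ^ k / fact k)) \<le> exp \<bar>Re (t *\<^sub>R b x)\<bar> * norm (t *\<^sub>R b x) ^ Suc 1 / fact 1"
      by (rule Taylor_exp)
    also have "\<dots> \<le> exp y * norm (t *\<^sub>R b x) ^ Suc 1 / fact 1"
    proof -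
      have "\<bar>Re (t *\<^sub>R b x)\<bar> \<le> norm (t *\<^sub>R b x)" by (rule abs_Re_le_cmod)
      also have "\<dots> \<le> y"
        using mult_right_mono[OF t, of "norm (b x)"] by (simp add: y_def)
      finally show ?thesis by (intro divide_right_mono mult_right_mono) auto
    qed
    also have "\<dots> = t\<^sup>2 * (8 / \<eta>\<^sup>2) * (y\<^sup>2 / 2 * exp y)"
      using \<eta> by (simp add: y_def power2_eq_square field_simps)
    also have "\<dots> \<le> t\<^sup>2 * (8 / \<eta>\<^sup>2) * (exp y * exp y)"
    proof -
      have "1 + y + y\<^sup>2 / 2 \<le> exp y" using y by (rule exp_lower_Taylor_quadratic)
      then have "y\<^sup>2 / 2 \<le> exp y" using y by linarith
      then show ?thesis by (intro mult_left_mono mult_right_mono) auto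
    qed
    also have "exp y * exp y = exp (\<eta> * norm (b x))"
      by (simp add: y_def exp_add[symmetric])
    finally have "norm (exp (t *\<^sub>R b x) - 1 - t *\<^sub>R b x) \<le> t\<^sup>2 * (8 / \<eta>\<^sup>2) * exp (\<eta> * norm (b x))"
      by (simp add: algebra_simps)
    from mult_left_mono[OF this, of "norm (a x)"]
    show ?thesis
      unfolding M_def norm_mult[symmetric] by (simp add: algebra_simps norm_mult[symmetric])
  qed
  show ?thesis
    unfolding has_vector_derivative_def
  proof (rule has_derivativeI_sandwich[where e = "\<eta> / 2" and H = "\<lambda>t. \<bar>t\<bar> * (8 / \<eta>\<^sup>2 * C)"])
    show "0 < \<eta> / 2" using \<eta> by simp
    show "bounded_linear (\<lambda>t. t *\<^sub>R (\<Sum>\<^sub>\<infinity>x\<in>A. a x * b x))" by (rule bounded_linear_scaleR_left)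
    show "((\<lambda>t. \<bar>t\<bar> * (8 / \<eta>\<^sup>2 * C)) \<longlongrightarrow> 0) (at 0)"
      by (rule tendsto_eq_intros | simp)+
    fix t :: real
    assume t: "t \<in> UNIV" "t \<noteq> 0" "dist t 0 < \<eta> / 2"
    have a0: "a summable_on A" using a_exp[of 0] \<eta> by simp
    have at: "(\<lambda>x. a x * exp (t *\<^sub>R b x)) summable_on A" using a_exp[of t] t \<eta> by simp
    have "norm ((\<Sum>\<^sub>\<infinity>x\<in>A. a x * exp (t *\<^sub>R b x)) - (\<Sum>\<^sub>\<infinity>x\<in>A. a x) - t *\<^sub>R (\<Sum>\<^sub>\<infinity>x\<in>A. a x * b x))
        \<le> (\<Sum>\<^sub>\<infinity>x\<in>A. t\<^sup>2 * (8 / \<eta>\<^sup>2) * M x)"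
    proof (rule norm_infsum_le)
      show "((\<lambda>x. a x * exp (t *\<^sub>R b x) - a x - t *\<^sub>R (a x * b x)) has_sum
          ((\<Sum>\<^sub>\<infinity>x\<in>A. a x * exp (t *\<^sub>R b x)) - (\<Sum>\<^sub>\<infinity>x\<in>A. a x) - t *\<^sub>R (\<Sum>\<^sub>\<infinity>x\<in>A. a x * b x))) A"
        using at a0 ab by (intro has_sum_diff has_sum_scaleR has_sum_infsum)
      show "((\<lambda>x. t\<^sup>2 * (8 / \<eta>\<^sup>2) * M x) has_sum (\<Sum>\<^sub>\<infinity>x\<in>A. t\<^sup>2 * (8 / \<eta>\<^sup>2) * M x)) A"
        by (intro has_sum_infsum summable_on_cmult_right M)
    qed (use rem t in auto)
    moreover have "(\<Sum>\<^sub>\<infinity>x\<in>A. t\<^sup>2 * (8 / \<eta>\<^sup>2) * M x) = \<bar>t\<bar> * (\<bar>t\<bar> * (8 / \<eta>\<^sup>2 * C))"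
      unfolding C_def by (subst infsum_cmult_right') (simp add: power2_eq_square)
    ultimately have "norm ((\<Sum>\<^sub>\<infinity>x\<in>A. a x * exp (t *\<^sub>R b x)) - (\<Sum>\<^sub>\<infinity>x\<in>A. a x) - t *\<^sub>R (\<Sum>\<^sub>\<infinity>x\<in>A. a x * b x))
       \<le> \<bar>t\<bar> * (\<bar>t\<bar> * (8 / \<eta>\<^sup>2 * C))" by simp
    then show "norm ((\<Sum>\<^sub>\<infinity>x\<in>A. a x * exp (t *\<^sub>R b x)) - (\<Sum>\<^sub>\<infinity>x\<in>A. a x * exp (0 *\<^sub>R b x))
         - (t - 0) *\<^sub>R (\<Sum>\<^sub>\<infinity>x\<in>A. a x * b x)) / norm (t - 0) \<le> \<bar>t\<bar> * (8 / \<eta>\<^sup>2 * C)"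
      using t by (simp add: field_simps)
  qed
qed

section \<open>Fourier series over positive definite \<open>T\<close> and their derivatives\<close>

definition cexp :: "real^2^2 \<Rightarrow> complex^2^2 \<Rightarrow> complex" where
  "cexp T Z = exp (2 * pi * \<i> * trace (complex_mat T 0 ** Z))"

text \<open>Summability is asked at all points at once, since differentiating at \<open>Z\<close>
  uses convergence at a point with smaller imaginary part.\<close>

definition summable_coeffs :: "(real^2^2) set \<Rightarrow> (real^2^2 \<Rightarrow> complex) \<Rightarrow> bool" where
  "summable_coeffs \<Lambda> g \<longleftrightarrow> (\<forall>Z\<in>siegel_H. (\<lambda>T. g T * cexp T Z) summable_on \<Lambda>)"

definition fourier_series :: "(real^2^2) set \<Rightarrow> (real^2^2 \<Rightarrow> complex) \<Rightarrow> complex^2^2 \<Rightarrow> complex" where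
  "fourier_series \<Lambda> g Z = (\<Sum>\<^sub>\<infinity>T\<in>\<Lambda>. g T * cexp T Z)"

lemma Im_mat_nth [simp]: "Im_mat Z $ i $ j = Im (Z $ i $ j)"
  by (simp add: Im_mat_def)

lemma complex_mat_nth [simp]: "complex_mat X Y $ i $ j = Complex (X $ i $ j) (Y $ i $ j)"
  by (simp add: complex_mat_def)

lemma coord_mat_nth [simp]:
  "coord_mat i j u $ p $ q = (if p = i \<and> q = j \<or> p = j \<and> q = i then u else 0)"
  by (simp add: coord_mat_def)

lemma mem_siegel_H_iff: "Z \<in> siegel_H \<longleftrightarrow> Z $ 2 $ 1 = Z $ 1 $ 2 \<and> posdef (Im_mat Z)"
  by (auto simp: siegel_H_def transpose_def vec_eq_iff forall_2)

lemma norm_cexp: "norm (cexp T Z) = exp (- 2 * pi * trace (T ** Im_mat Z))"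
  by (simp add: cexp_def trace_mult_2 algebra_simps)

lemma cexp_add_scaleR:
  "cexp T (Z + t *\<^sub>R V) = cexp T Z * exp (t *\<^sub>R (2 * pi * \<i> * trace (complex_mat T 0 ** V)))"
  unfolding cexp_def exp_add[symmetric]
  by (rule arg_cong[where f = exp]) (simp add: trace_mult_2, simp add: scaleR_conv_of_real algebra_simps)

text \<open>Makes the trace a measure of the size of \<open>T\<close>: polynomial factors in the
  entries are bounded by powers of a quantity that the exponential controls.\<close>

lemma posdef_norm_le_trace:
  assumes "posdef T"
  shows "\<bar>T $ i $ j\<bar> \<le> trace T"
proof -
  define a b c where abc: "a = T $ 1 $ 1" "b = T $ 1 $ 2" "c = T $ 2 $ 2"
  have T: "T $ 2 $ 1 = b" "0 < a" "0 < a * c - b\<^sup>2"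
    using assms by (simp_all add: posdef_iff abc)
  have ac: "0 < a * c" using T(3) zero_le_power2[of b] by linarith
  then have c: "0 < c" using T(2) by (simp add: zero_less_mult_iff)
  have "\<bar>b\<bar>\<^sup>2 \<le> (a + c)\<^sup>2"
    using T(3) ac zero_le_power2[of a] zero_le_power2[of c]
    unfolding power2_sum power2_abs mult.assoc by linarith
  then have "\<bar>b\<bar> \<le> a + c" by (rule power2_le_imp_le) (use T c in simp)
  then have "\<forall>i j. \<bar>T $ i $ j\<bar> \<le> a + c"
    using T c by (auto simp: forall_2 abc[symmetric])
  then show ?thesis by (simp add: trace_def sum_2 abc)
qed

lemma norm_trace_complex_mat_le:
  assumes "posdef T"
  shows "norm (trace (complex_mat T 0 ** V)) \<le> (\<Sum>i\<in>UNIV. \<Sum>j\<in>UNIV. norm (V $ i $ j)) * trace T"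
proof -
  have *: "norm (Complex (T $ i $ j) 0 * V $ k $ l) \<le> norm (V $ k $ l) * trace T" for i j k l
    using mult_right_mono[OF posdef_norm_le_trace[OF assms, of i j], of "norm (V $ k $ l)"]
    by (simp add: norm_mult complex_norm mult.commute)
  show ?thesis
    unfolding trace_mult_2 complex_mat_nth zero_index
    by (rule order_trans[OF norm_triangle_mono[OF norm_triangle_mono[OF norm_triangle_mono[OF
          *[of 1 1 1 1] *[of 1 2 2 1]] *[of 2 1 1 2]] *[of 2 2 2 2]]])
      (simp add: sum_2 distrib_right)
qed

text \<open>Shrinking the imaginary part gains the factor \<open>exp(2\<pi>\<delta> tr(T))\<close>, which absorbs every
  polynomial in \<open>T\<close>.\<close>

lemma siegel_H_shift:
  assumes "Z \<in> siegel_H"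
  obtains \<delta> where "\<delta> > 0" "Z - complex_mat 0 (mat \<delta>) \<in> siegel_H"
proof -
  let ?Y = "Im_mat Z"
  have Y: "Z $ 2 $ 1 = Z $ 1 $ 2" "0 < ?Y $ 1 $ 1" "0 < ?Y $ 1 $ 1 * ?Y $ 2 $ 2 - (?Y $ 1 $ 2)\<^sup>2"
    using assms unfolding mem_siegel_H_iff posdef_iff by auto
  have "((\<lambda>\<delta>. ?Y $ 1 $ 1 - \<delta>) \<longlongrightarrow> ?Y $ 1 $ 1 - 0) (at_right 0)"
    by (intro tendsto_intros)
  then have "\<forall>\<^sub>F \<delta> in at_right 0. 0 < ?Y $ 1 $ 1 - \<delta>"
    by (rule order_tendstoD) (use Y in simp)
  moreover have "((\<lambda>\<delta>. (?Y $ 1 $ 1 - \<delta>) * (?Y $ 2 $ 2 - \<delta>) - (?Y $ 1 $ 2)\<^sup>2) \<longlongrightarrow>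
      (?Y $ 1 $ 1 - 0) * (?Y $ 2 $ 2 - 0) - (?Y $ 1 $ 2)\<^sup>2) (at_right 0)"
    by (intro tendsto_intros)
  then have "\<forall>\<^sub>F \<delta> in at_right 0. 0 < (?Y $ 1 $ 1 - \<delta>) * (?Y $ 2 $ 2 - \<delta>) - (?Y $ 1 $ 2)\<^sup>2"
    by (rule order_tendstoD) (use Y in simp)
  moreover have "\<forall>\<^sub>F \<delta> in at_right (0::real). 0 < \<delta>" by (rule eventually_at_right_less)
  ultimately have "\<forall>\<^sub>F \<delta> in at_right 0. \<delta> > 0 \<and> Z - complex_mat 0 (mat \<delta>) \<in> siegel_H"
  proof eventually_elim
    case (elim \<delta>)
    then show ?case using Y(1) by (simp add: mem_siegel_H_iff posdef_iff mat_def)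
  qed
  then have "\<exists>\<delta>. \<delta> > 0 \<and> Z - complex_mat 0 (mat \<delta>) \<in> siegel_H"
    by (rule eventually_happens'[rotated]) simp
  then show ?thesis using that by blast
qed

text \<open>The half space is open in the symmetric matrices, so derivatives along symmetric
  directions depend only on values inside it.\<close>

lemma eventually_siegel_H:
  assumes "Z \<in> siegel_H" and V: "V $ 2 $ 1 = V $ 1 $ 2"
  shows "\<forall>\<^sub>F t in at (0::real). Z + t *\<^sub>R V \<in> siegel_H"
proof -
  let ?Y = "Im_mat Z" and ?V = "Im_mat V"
  have Y: "Z $ 2 $ 1 = Z $ 1 $ 2" "0 < ?Y $ 1 $ 1" "0 < ?Y $ 1 $ 1 * ?Y $ 2 $ 2 - (?Y $ 1 $ 2)\<^sup>2"
    using assms unfolding mem_siegel_H_iff posdef_iff by auto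
  have "((\<lambda>t. ?Y $ 1 $ 1 + t * ?V $ 1 $ 1) \<longlongrightarrow> ?Y $ 1 $ 1 + 0 * ?V $ 1 $ 1) (at 0)"
    by (intro tendsto_intros)
  then have "\<forall>\<^sub>F t in at 0. 0 < ?Y $ 1 $ 1 + t * ?V $ 1 $ 1"
    by (rule order_tendstoD) (use Y in simp)
  moreover have "((\<lambda>t. (?Y $ 1 $ 1 + t * ?V $ 1 $ 1) * (?Y $ 2 $ 2 + t * ?V $ 2 $ 2) - (?Y $ 1 $ 2 + t * ?V $ 1 $ 2)\<^sup>2) \<longlongrightarrow>
      (?Y $ 1 $ 1 + 0 * ?V $ 1 $ 1) * (?Y $ 2 $ 2 + 0 * ?V $ 2 $ 2) - (?Y $ 1 $ 2 + 0 * ?V $ 1 $ 2)\<^sup>2) (at 0)"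
    by (intro tendsto_intros)
  then have "\<forall>\<^sub>F t in at 0. 0 < (?Y $ 1 $ 1 + t * ?V $ 1 $ 1) * (?Y $ 2 $ 2 + t * ?V $ 2 $ 2) - (?Y $ 1 $ 2 + t * ?V $ 1 $ 2)\<^sup>2"
    by (rule order_tendstoD) (use Y in simp)
  ultimately show ?thesis
  proof eventually_elim
    case (elim t)
    then show ?case using Y(1) V by (simp add: mem_siegel_H_iff posdef_iff)
  qed
qed

lemma norm_cexp_shift:
  "norm (cexp T (Z - complex_mat 0 (mat \<delta>))) = norm (cexp T Z) * exp (2 * pi * \<delta> * trace T)"
  unfolding norm_cexp exp_add[symmetric] trace_mult_2
  by (rule arg_cong[where f = exp]) (simp add: mat_def trace_def sum_2 algebra_simps)

lemma summable_coeffs_norm: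
  assumes "summable_coeffs \<Lambda> g" "Z \<in> siegel_H"
  shows "(\<lambda>T. norm (g T) * norm (cexp T Z)) summable_on \<Lambda>"
proof -
  have "(\<lambda>T. g T * cexp T Z) summable_on \<Lambda>" using assms by (simp add: summable_coeffs_def)
  then have "(\<lambda>T. norm (g T * cexp T Z)) summable_on \<Lambda>"
    by (rule summable_on_iff_abs_summable_on_complex[THEN iffD1])
  then show ?thesis by (simp add: norm_mult)
qed

text \<open>Each derivative costs a factor linear in \<open>T\<close>. It is dominated by
  \<open>exp (2 * pi * \<delta> * trace T)\<close>, which is the gain from moving \<open>Z\<close>
  to the shifted point.\<close>

lemma summable_coeffs_mono:
  assumes \<Lambda>: "\<Lambda> \<subseteq> Collect posdef" and g: "summable_coeffs \<Lambda> g"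
    and le: "\<And>T. T \<in> \<Lambda> \<Longrightarrow> norm (f T) \<le> norm (g T) * (B * trace T)" and B: "B \<ge> 0"
  shows "summable_coeffs \<Lambda> f"
  unfolding summable_coeffs_def
proof
  fix Z assume "Z \<in> siegel_H"
  then obtain \<delta> where \<delta>: "\<delta> > 0" "Z - complex_mat 0 (mat \<delta>) \<in> siegel_H"
    by (rule siegel_H_shift)
  show "(\<lambda>T. f T * cexp T Z) summable_on \<Lambda>"
  proof (rule abs_summable_summable, rule Infinite_Sum.abs_summable_on_comparison_test')
    show "(\<lambda>T. B / (2 * pi * \<delta>) * (norm (g T) * norm (cexp T (Z - complex_mat 0 (mat \<delta>))))) summable_on \<Lambda>"
      by (intro summable_on_cmult_right summable_coeffs_norm[OF g \<delta>(2)])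
    fix T assume T: "T \<in> \<Lambda>"
    have "2 * pi * \<delta> * trace T \<le> exp (2 * pi * \<delta> * trace T)"
      using exp_ge_add_one_self[of "2 * pi * \<delta> * trace T"] by linarith
    then have "trace T \<le> exp (2 * pi * \<delta> * trace T) / (2 * pi * \<delta>)"
      using \<delta> by (simp add: field_simps)
    then have "norm (g T) * (B * trace T) \<le> norm (g T) * (B * (exp (2 * pi * \<delta> * trace T) / (2 * pi * \<delta>)))"
      using B by (intro mult_left_mono) auto
    with le[OF T] have "norm (f T) \<le> norm (g T) * (B * (exp (2 * pi * \<delta> * trace T) / (2 * pi * \<delta>)))"
      by linarith
    from mult_right_mono[OF this, of "norm (cexp T Z)"]
    show "norm (f T * cexp T Z) \<le> B / (2 * pi * \<delta>) * (norm (g T) * norm (cexp T (Z - complex_mat 0 (mat \<delta>))))"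
      unfolding norm_cexp_shift by (simp add: norm_mult mult_ac)
  qed
qed

lemma has_vector_derivative_fourier_series:
  assumes \<Lambda>: "\<Lambda> \<subseteq> Collect posdef" and g: "summable_coeffs \<Lambda> g" and Z: "Z \<in> siegel_H"
  shows "((\<lambda>t::real. fourier_series \<Lambda> g (Z + t *\<^sub>R V)) has_vector_derivative
        fourier_series \<Lambda> (\<lambda>T. g T * (2 * pi * \<i> * trace (complex_mat T 0 ** V))) Z) (at 0)"
proof -
  define K where "K = (\<Sum>i\<in>UNIV. \<Sum>j\<in>UNIV. norm (V $ i $ j))"
  have K: "K \<ge> 0" by (simp add: K_def sum_nonneg)
  define b where "b T = 2 * pi * \<i> * trace (complex_mat T 0 ** V)" for T
  have b: "norm (b T) \<le> (2 * pi * K) * trace T" if "T \<in> \<Lambda>" for T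
    using norm_trace_complex_mat_le[of T V] that \<Lambda> by (auto simp: b_def norm_mult K_def)
  from Z obtain \<delta> where \<delta>: "\<delta> > 0" "Z - complex_mat 0 (mat \<delta>) \<in> siegel_H"
    by (rule siegel_H_shift)
  have "((\<lambda>t::real. \<Sum>\<^sub>\<infinity>T\<in>\<Lambda>. (g T * cexp T Z) * exp (t *\<^sub>R b T)) has_vector_derivative
     (\<Sum>\<^sub>\<infinity>T\<in>\<Lambda>. (g T * cexp T Z) * b T)) (at 0)"
  proof (rule has_vector_derivative_infsum_exp)
    \<comment> \<open>Since \<open>norm (b T)\<close> is at most
      \<open>2 * pi * K * trace T\<close>, this radius keeps the majorant below the gain from the
      shift. The summand 1 covers \<open>V = 0\<close>, where \<open>\<delta> / K\<close> would be
      0.\<close>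
    show "\<delta> / (K + 1) > 0" using \<delta> K by simp
    show "(\<lambda>T. norm (g T * cexp T Z) * exp (\<delta> / (K + 1) * norm (b T))) summable_on \<Lambda>"
    proof (rule summable_on_comparison_test[OF summable_coeffs_norm[OF g \<delta>(2)]])
      fix T assume T: "T \<in> \<Lambda>"
      then have "0 \<le> trace T" using \<Lambda> posdef_norm_le_trace[of T 1 1] by force
      have "\<delta> / (K + 1) * norm (b T) \<le> \<delta> / (K + 1) * ((2 * pi * (K + 1)) * trace T)"
        using \<delta> K \<open>0 \<le> trace T\<close>
        by (intro mult_left_mono order_trans[OF b[OF T]] mult_right_mono) auto
      also have "\<dots> = 2 * pi * \<delta> * trace T"
        using K by (simp add: field_simps)
      finally have "exp (\<delta> / (K + 1) * norm (b T)) \<le> exp (2 * pi * \<delta> * trace T)" by simp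
      then show "norm (g T * cexp T Z) * exp (\<delta> / (K + 1) * norm (b T)) \<le>
          norm (g T) * norm (cexp T (Z - complex_mat 0 (mat \<delta>)))"
        unfolding norm_cexp_shift by (simp add: norm_mult mult.assoc mult_left_mono)
    qed auto
  qed
  then show "((\<lambda>t::real. fourier_series \<Lambda> g (Z + t *\<^sub>R V)) has_vector_derivative
        fourier_series \<Lambda> (\<lambda>T. g T * (2 * pi * \<i> * trace (complex_mat T 0 ** V))) Z) (at 0)"
    unfolding fourier_series_def cexp_add_scaleR b_def[symmetric] by (simp add: mult_ac)
qed

section \<open>The Maass operator on Fourier series\<close>

text \<open>\<open>partial_Z\<close> is built from \<open>vector_derivative\<close>, a choice that
  says nothing where no derivative exists. The relation records existence as well, so that sum and
  product rules can be chained.\<close>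

definition has_partial_Z ::
    "2 \<Rightarrow> 2 \<Rightarrow> (complex^2^2 \<Rightarrow> complex) \<Rightarrow> complex \<Rightarrow> complex^2^2 \<Rightarrow> bool" where
  "has_partial_Z i j F D Z \<longleftrightarrow> (\<exists>D1 D2.
     ((\<lambda>t::real. F (Z + t *\<^sub>R coord_mat i j 1)) has_vector_derivative D1) (at 0) \<and>
     ((\<lambda>t::real. F (Z + t *\<^sub>R coord_mat i j \<i>)) has_vector_derivative D2) (at 0) \<and>
     D = (1 + (if i = j then 1 else 0)) / 2 * ((D1 - \<i> * D2) / 2))"

lemma has_partial_Z_imp: "has_partial_Z i j F D Z \<Longrightarrow> partial_Z i j F Z = D"
  unfolding has_partial_Z_def partial_Z_def dir_deriv_def by (auto dest!: vector_derivative_at)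

lemma has_partial_Z_add:
  assumes "has_partial_Z i j F D Z" "has_partial_Z i j G E Z"
  shows "has_partial_Z i j (\<lambda>W. F W + G W) (D + E) Z"
proof -
  from assms obtain D1 D2 E1 E2 where *:
    "((\<lambda>t::real. F (Z + t *\<^sub>R coord_mat i j 1)) has_vector_derivative D1) (at 0)"
    "((\<lambda>t::real. F (Z + t *\<^sub>R coord_mat i j \<i>)) has_vector_derivative D2) (at 0)"
    "((\<lambda>t::real. G (Z + t *\<^sub>R coord_mat i j 1)) has_vector_derivative E1) (at 0)"
    "((\<lambda>t::real. G (Z + t *\<^sub>R coord_mat i j \<i>)) has_vector_derivative E2) (at 0)"
    "D = (1 + (if i = j then 1 else 0)) / 2 * ((D1 - \<i> * D2) / 2)"
    "E = (1 + (if i = j then 1 else 0)) / 2 * ((E1 - \<i> * E2) / 2)"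
    unfolding has_partial_Z_def by blast
  show ?thesis
    unfolding has_partial_Z_def *(5,6)
    by (rule exI[of _ "D1 + E1"], rule exI[of _ "D2 + E2"])
       (intro conjI has_vector_derivative_add *(1-4), simp add: field_simps)
qed

lemma has_partial_Z_mult:
  assumes "has_partial_Z i j F D Z" "has_partial_Z i j G E Z"
  shows "has_partial_Z i j (\<lambda>W. F W * G W) (F Z * E + D * G Z) Z"
proof -
  from assms obtain D1 D2 E1 E2 where *:
    "((\<lambda>t::real. F (Z + t *\<^sub>R coord_mat i j 1)) has_vector_derivative D1) (at 0)"
    "((\<lambda>t::real. F (Z + t *\<^sub>R coord_mat i j \<i>)) has_vector_derivative D2) (at 0)"
    "((\<lambda>t::real. G (Z + t *\<^sub>R coord_mat i j 1)) has_vector_derivative E1) (at 0)"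
    "((\<lambda>t::real. G (Z + t *\<^sub>R coord_mat i j \<i>)) has_vector_derivative E2) (at 0)"
    "D = (1 + (if i = j then 1 else 0)) / 2 * ((D1 - \<i> * D2) / 2)"
    "E = (1 + (if i = j then 1 else 0)) / 2 * ((E1 - \<i> * E2) / 2)"
    unfolding has_partial_Z_def by blast
  have "((\<lambda>t::real. F (Z + t *\<^sub>R coord_mat i j 1) * G (Z + t *\<^sub>R coord_mat i j 1))
      has_vector_derivative (F Z * E1 + D1 * G Z)) (at 0)"
    "((\<lambda>t::real. F (Z + t *\<^sub>R coord_mat i j \<i>) * G (Z + t *\<^sub>R coord_mat i j \<i>))
      has_vector_derivative (F Z * E2 + D2 * G Z)) (at 0)"
    using has_vector_derivative_mult[OF *(1,3)] has_vector_derivative_mult[OF *(2,4)] by simp_all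
  then show ?thesis
    unfolding has_partial_Z_def *(5,6)
    by - (rule exI[of _ "F Z * E1 + D1 * G Z"], rule exI[of _ "F Z * E2 + D2 * G Z"], auto simp: field_simps)
qed

lemma has_partial_Z_const: "has_partial_Z i j (\<lambda>_. c) 0 Z"
  unfolding has_partial_Z_def by (intro exI[of _ 0]) simp

lemma has_partial_Z_cmult: "has_partial_Z i j F D Z \<Longrightarrow> has_partial_Z i j (\<lambda>W. c * F W) (c * D) Z"
  using has_partial_Z_mult[OF has_partial_Z_const, of i j F D Z c] by simp

text \<open>Serves iterated derivatives: the formula for the inner \<open>partial_Z\<close> holds
  only on \<open>siegel_H\<close>, and openness along the coordinate directions makes that
  enough.\<close>

lemma has_partial_Z_cong:
  assumes "has_partial_Z i j F D Z" "Z \<in> siegel_H" and eq: "\<And>W. W \<in> siegel_H \<Longrightarrow> G W = F W"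
  shows "has_partial_Z i j G D Z"
proof -
  have *: "((\<lambda>t::real. G (Z + t *\<^sub>R coord_mat i j u)) has_vector_derivative D') (at 0)"
    if "((\<lambda>t::real. F (Z + t *\<^sub>R coord_mat i j u)) has_vector_derivative D') (at 0)" for u D'
  proof -
    have "\<forall>\<^sub>F t in at (0::real). Z + t *\<^sub>R coord_mat i j u \<in> siegel_H"
      using assms(2) by (rule eventually_siegel_H) auto
    then have "\<forall>\<^sub>F t in at (0::real). F (Z + t *\<^sub>R coord_mat i j u) = G (Z + t *\<^sub>R coord_mat i j u)"
      by eventually_elim (simp add: eq)
    with that show ?thesis
      unfolding has_vector_derivative_def
      by (rule has_derivative_transform_eventually) (simp_all add: assms(2) eq)
  qed
  from assms(1) show ?thesis unfolding has_partial_Z_def using * by blast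
qed

text \<open>A function of \<open>Y\<close> alone has derivative 0 in the real directions, so the
  Wirtinger derivative reduces to \<open>- \<i> / 2\<close> times the derivative in
  \<open>Y\<close>.\<close>

lemma has_partial_Z_of_real_Im:
  assumes "\<And>X. Im_mat X = 0 \<Longrightarrow> u (Z + X) = u Z"
    and "((\<lambda>t::real. u (Z + t *\<^sub>R coord_mat i j \<i>)) has_real_derivative d) (at 0)"
    and "D = (1 + (if i = j then 1 else 0)) / 4 * (- \<i> * of_real d)"
  shows "has_partial_Z i j (\<lambda>W. complex_of_real (u W)) D Z"
proof -
  have "Im_mat (t *\<^sub>R coord_mat i j 1) = 0" for t :: real
    by (simp add: vec_eq_iff)
  then have "((\<lambda>t::real. complex_of_real (u (Z + t *\<^sub>R coord_mat i j 1))) has_vector_derivative 0) (at 0)"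
    using assms(1) by simp
  moreover have "((\<lambda>t::real. complex_of_real (u (Z + t *\<^sub>R coord_mat i j \<i>))) has_vector_derivative of_real d) (at 0)"
    using assms(2) by (rule has_vector_derivative_of_real)
  ultimately show ?thesis
    unfolding has_partial_Z_def by (intro exI[of _ 0] exI[of _ "of_real d"]) (simp add: assms(3))
qed

lemma has_partial_Z_Im:
  "has_partial_Z 1 1 (\<lambda>W. of_real (Im (W $ 1 $ 1))) (- \<i> / 2) Z"
  "has_partial_Z 1 2 (\<lambda>W. of_real (Im (W $ 1 $ 2))) (- \<i> / 4) Z"
proof -
  have "((\<lambda>t::real. Im ((Z + t *\<^sub>R coord_mat i j \<i>) $ i $ j)) has_real_derivative 1) (at 0)" for i j
    by (auto intro!: derivative_eq_intros)
  note * = has_partial_Z_of_real_Im[where d = 1, OF _ this]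
  show "has_partial_Z 1 1 (\<lambda>W. of_real (Im (W $ 1 $ 1))) (- \<i> / 2) Z"
    by (rule *) (simp_all add: vec_eq_iff)
  show "has_partial_Z 1 2 (\<lambda>W. of_real (Im (W $ 1 $ 2))) (- \<i> / 4) Z"
    by (rule *) (simp_all add: vec_eq_iff)
qed

lemma has_partial_Z_det_powr:
  assumes Z: "Z \<in> siegel_H"
  shows "has_partial_Z 1 1 (\<lambda>W. of_real (det (Im_mat W) powr \<beta>))
      (of_real (\<beta> * det (Im_mat Z) powr (\<beta> - 1) * Im (Z $ 2 $ 2)) * (- \<i> / 2)) Z" (is ?th11)
    and "has_partial_Z 2 2 (\<lambda>W. of_real (det (Im_mat W) powr \<beta>))
      (of_real (\<beta> * det (Im_mat Z) powr (\<beta> - 1) * Im (Z $ 1 $ 1)) * (- \<i> / 2)) Z" (is ?th22)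
    and "has_partial_Z 1 2 (\<lambda>W. of_real (det (Im_mat W) powr \<beta>))
      (of_real (\<beta> * det (Im_mat Z) powr (\<beta> - 1) * Im (Z $ 1 $ 2)) * (\<i> / 2)) Z" (is ?th12)
proof -
  have sym: "Z $ 2 $ 1 = Z $ 1 $ 2" and pos: "det (Im_mat Z) > 0"
    using Z posdef_det_pos unfolding mem_siegel_H_iff by auto
  then have pos': "Im (Z $ 1 $ 1) * Im (Z $ 2 $ 2) - Im (Z $ 1 $ 2) * Im (Z $ 1 $ 2) > 0"
    by (simp add: det_2)
  have inv: "det (Im_mat (Z + X)) powr \<beta> = det (Im_mat Z) powr \<beta>" if "Im_mat X = 0" for X
    using that by (simp add: det_2 vec_eq_iff)
  show ?th11
    by (rule has_partial_Z_of_real_Im[OF inv, where d = "\<beta> * det (Im_mat Z) powr (\<beta> - 1) * Im (Z $ 2 $ 2)"])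
       (use pos' in \<open>auto simp: det_2 sym intro!: derivative_eq_intros\<close>)
  show ?th22
    by (rule has_partial_Z_of_real_Im[OF inv, where d = "\<beta> * det (Im_mat Z) powr (\<beta> - 1) * Im (Z $ 1 $ 1)"])
       (use pos' in \<open>auto simp: det_2 sym intro!: derivative_eq_intros\<close>)
  show ?th12
    \<comment> \<open>The off-diagonal entry occurs twice in the determinant, whence
      \<open>- 2\<close>; with the off-diagonal weight \<open>1/4\<close> and the factor
      \<open>- \<i>\<close> this gives \<open>\<i> / 2\<close>.\<close>
    by (rule has_partial_Z_of_real_Im[OF inv, where d = "\<beta> * det (Im_mat Z) powr (\<beta> - 1) * (- 2 * Im (Z $ 1 $ 2))"])
       (use pos' in \<open>auto simp: det_2 sym intro!: derivative_eq_intros\<close>)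
qed

text \<open>An off-diagonal coordinate is counted twice in the trace form; the weight
  \<open>(1 + \<delta>) / 2\<close> in the Maass operator compensates exactly for this.\<close>

lemma trace_coord_mat:
  assumes "posdef T"
  shows "complex_of_real (T $ i $ j) = (1 + (if i = j then 1 else 0)) / 2 * trace (complex_mat T 0 ** coord_mat i j 1)"
proof -
  have sym: "T $ 2 $ 1 = T $ 1 $ 2" using assms by (simp add: posdef_iff)
  consider "i = 1" "j = 1" | "i = 1" "j = 2" | "i = 2" "j = 1" | "i = 2" "j = 2"
    using exhaust_2[of i] exhaust_2[of j] by auto
  then show ?thesis
  proof cases
    case 1 show ?thesis unfolding 1 trace_mult_2 coord_mat_nth complex_mat_nth zero_index by simp (simp add: complex_eq_iff)
  next
    case 2 show ?thesis unfolding 2 trace_mult_2 coord_mat_nth complex_mat_nth zero_index by simp (simp add: complex_eq_iff sym)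
  next
    case 3 show ?thesis unfolding 3 trace_mult_2 coord_mat_nth complex_mat_nth zero_index by simp (simp add: complex_eq_iff sym)
  next
    case 4 show ?thesis unfolding 4 trace_mult_2 coord_mat_nth complex_mat_nth zero_index by simp (simp add: complex_eq_iff)
  qed
qed

lemma trace_coord_mat_i:
  "trace (complex_mat T 0 ** coord_mat i j \<i>) = \<i> * trace (complex_mat T 0 ** coord_mat i j 1)"
proof -
  have "coord_mat i j \<i> $ p $ q = \<i> * coord_mat i j 1 $ p $ q" for p q by simp
  then show ?thesis by (simp only: trace_mult_2 distrib_left mult.left_commute)
qed

lemma has_partial_Z_fourier_series:
  assumes \<Lambda>: "\<Lambda> \<subseteq> Collect posdef" and g: "summable_coeffs \<Lambda> g" and Z: "Z \<in> siegel_H"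
  shows "has_partial_Z i j (fourier_series \<Lambda> g) (fourier_series \<Lambda> (\<lambda>T. g T * (2 * pi * \<i> * T $ i $ j)) Z) Z"
proof -
  define w :: complex where "w = (1 + (if i = j then 1 else 0)) / 2"
  have tr: "T $ i $ j = w * trace (complex_mat T 0 ** coord_mat i j 1)" if "T \<in> \<Lambda>" for T
    unfolding w_def by (rule trace_coord_mat) (use that \<Lambda> in auto)
  let ?D = "\<lambda>u. fourier_series \<Lambda> (\<lambda>T. g T * (2 * pi * \<i> * trace (complex_mat T 0 ** coord_mat i j u))) Z"
  \<comment> \<open>Holomorphy of the terms: the two real derivatives differ by the factor
    \<open>\<i>\<close>, so the Wirtinger combination equals \<open>?D 1\<close>.\<close>
  have D2: "?D \<i> = \<i> * ?D 1"
    unfolding fourier_series_def infsum_cmult_right'[symmetric] trace_coord_mat_i by (simp add: mult_ac)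
  have "fourier_series \<Lambda> (\<lambda>T. g T * (2 * pi * \<i> * T $ i $ j)) Z = w * ?D 1"
    unfolding fourier_series_def infsum_cmult_right'[symmetric]
    by (rule infsum_cong) (simp add: tr mult_ac)
  also have "w * ?D 1 = w * ((?D 1 - \<i> * ?D \<i>) / 2)"
    unfolding D2 by simp
  finally show ?thesis
    unfolding has_partial_Z_def w_def
    by - (rule exI[of _ "?D 1"], rule exI[of _ "?D \<i>"],
      intro conjI has_vector_derivative_fourier_series[OF \<Lambda> g Z], assumption)
qed

text \<open>The factor \<open>P_T(Y)\<close> of the introduction, written with
  \<open>\<alpha> = k - 1/2\<close> and hence \<open>\<alpha> + 1/2 = k\<close>.\<close>

definition maass_weight :: "nat \<Rightarrow> real^2^2 \<Rightarrow> real^2^2 \<Rightarrow> real" where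
  "maass_weight k T Y = 16 * pi\<^sup>2 * det T -
     (4 * pi * (real k - 1/2) * trace (T ** Y) - (real k - 1/2) * real k) / det Y"

lemma summable_coeffs_coord:
  assumes \<Lambda>: "\<Lambda> \<subseteq> Collect posdef" and g: "summable_coeffs \<Lambda> g"
  shows "summable_coeffs \<Lambda> (\<lambda>T. g T * (2 * pi * \<i> * T $ i $ j))"
proof (rule summable_coeffs_mono[OF \<Lambda> g, where B = "2 * pi"])
  fix T assume "T \<in> \<Lambda>"
  then have "2 * pi * \<bar>T $ i $ j\<bar> \<le> 2 * pi * trace T"
    using \<Lambda> by (intro mult_left_mono posdef_norm_le_trace) auto
  from mult_left_mono[OF this, of "norm (g T)"]
  show "norm (g T * (2 * pi * \<i> * T $ i $ j)) \<le> norm (g T) * (2 * pi * trace T)"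
    by (simp add: norm_mult)
qed simp

text \<open>No interchange of derivatives is involved: both operators vary the same coordinate of a
  symmetric matrix.\<close>

lemma partial_Z_commute: "partial_Z 2 1 = partial_Z 1 2"
proof -
  have "coord_mat 2 1 u = coord_mat 1 2 u" for u by (simp add: vec_eq_iff disj_commute)
  then show ?thesis by (simp add: fun_eq_iff partial_Z_def)
qed

text \<open>The algebra of the second derivatives: \<open>u\<close>, \<open>v\<close>,
  \<open>w\<close> are the entries of \<open>Y\<close>, \<open>P\<close> is \<open>det(Y)\<close> to
  the power \<open>a\<close>, and the \<open>s\<close> variables are the series and its derivatives.
  The coefficient of \<open>s0\<close> is Cayley's identity: the determinant of the operator matrix
  sends \<open>det(Y)\<close> to the power \<open>a\<close> to \<open>a * (a + 1/2)\<close> times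
  the next lower power, up to the constant \<open>- 1/4\<close>.\<close>

lemma maass_bracket_eq:
  fixes P Q a d u v w s0 s1 s2 s3 s21 s33 :: complex
  assumes d: "d = u * v - w * w" "d \<noteq> 0"
  shows "P * (s21 - s33 - \<i> * a / 2 / d * (v * s2 + u * s1 + 2 * (w * s3)) - a * (a + 1/2) / 4 / d * s0) =
    (P * s21 + - \<i> / 2 * a * (P / d * v) * s2 +
      (- \<i> / 2 * a * (P / d * u) * s1 +
       - \<i> / 2 * a * (P / d * (- \<i> / 2) + - \<i> / 2 * (a - 1) * (P / d / d * v) * u) * s0)) -
    (P * s33 + \<i> / 2 * a * (P / d * w) * s3 +
      (\<i> / 2 * a * (P / d * w) * s3 +
       \<i> / 2 * a * (P / d * (- \<i> / 4) + \<i> / 2 * (a - 1) * (P / d / d * w) * w) * s0))"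
proof -
  \<comment> \<open>Writing everything through \<open>r\<close> clears the denominators of
    \<open>P / d\<close> and \<open>P / d / d\<close>.\<close>
  define r where "r = P / d / d"
  have P: "P = r * d * d" using d(2) by (simp add: r_def)
  show ?thesis
    unfolding P using d(2)
    by (simp add: power2_eq_square algebra_simps diff_divide_distrib add_divide_distrib)
       (simp add: d(1) power2_eq_square algebra_simps diff_divide_distrib add_divide_distrib)
qed

text \<open>Two applications of the product rule express the operator through differentiated series
  with coefficients depending only on \<open>Y\<close>; linearity then recombines them into one
  series, whose coefficients are compared term by term.\<close>

lemma has_sum_maass_op:
  assumes \<Lambda>: "\<Lambda> \<subseteq> Collect posdef" and g: "summable_coeffs \<Lambda> g"
    and h: "\<And>W. W \<in> siegel_H \<Longrightarrow> h W = fourier_series \<Lambda> g W" and Z: "Z \<in> siegel_H"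
  shows "((\<lambda>T. g T * of_real (maass_weight k T (Im_mat Z)) * cexp T Z) has_sum maass_op k h Z) \<Lambda>"
proof -
  define \<alpha> where "\<alpha> = real k - 1/2"
  define \<Delta> where "\<Delta> \<beta> W = complex_of_real (det (Im_mat W) powr \<beta>)" for \<beta> W
  define S where "S = fourier_series \<Lambda>"
  define D where "D i j c T = c T * (2 * pi * \<i> * T $ i $ j)" for i j and c :: "real^2^2 \<Rightarrow> complex" and T :: "real^2^2"
  have sD: "summable_coeffs \<Lambda> (D i j c)" if "summable_coeffs \<Lambda> c" for i j c
    unfolding D_def using \<Lambda> that by (rule summable_coeffs_coord)
  have pS: "has_partial_Z i j (S c) (S (D i j c) W) W" if "summable_coeffs \<Lambda> c" "W \<in> siegel_H" for i j c W
    unfolding S_def D_def[abs_def] using \<Lambda> that by (rule has_partial_Z_fourier_series)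
  define y where "y i j W = complex_of_real (Im (W $ i $ j))" for i j :: 2 and W :: "complex^2^2"
  have p\<Delta>: "has_partial_Z 1 1 (\<Delta> \<beta>) (- \<i> / 2 * \<beta> * (\<Delta> (\<beta> - 1) W * y 2 2 W)) W"
      "has_partial_Z 2 2 (\<Delta> \<beta>) (- \<i> / 2 * \<beta> * (\<Delta> (\<beta> - 1) W * y 1 1 W)) W"
      "has_partial_Z 1 2 (\<Delta> \<beta>) (\<i> / 2 * \<beta> * (\<Delta> (\<beta> - 1) W * y 1 2 W)) W"
    if "W \<in> siegel_H" for \<beta> W
    using has_partial_Z_det_powr[OF that, of \<beta>] by (simp_all add: \<Delta>_def[abs_def] y_def mult_ac)
  have py: "has_partial_Z 1 1 (y 1 1) (- \<i> / 2) W" "has_partial_Z 1 2 (y 1 2) (- \<i> / 4) W" for W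
    using has_partial_Z_Im[of W] by (simp_all add: y_def[abs_def])
  let ?G = "\<lambda>W. complex_of_real (det (Im_mat W) powr (real k - 1/2)) * h W"
  have G: "?G W = \<Delta> \<alpha> W * S g W" if "W \<in> siegel_H" for W
    using h[OF that] by (simp add: \<Delta>_def \<alpha>_def S_def)
  have G22: "partial_Z 2 2 ?G W =
      \<Delta> \<alpha> W * S (D 2 2 g) W + - \<i> / 2 * \<alpha> * (\<Delta> (\<alpha> - 1) W * y 1 1 W) * S g W" if W: "W \<in> siegel_H" for W
    by (rule has_partial_Z_imp[OF has_partial_Z_cong[OF has_partial_Z_mult[OF p\<Delta>(2)[OF W] pS[OF g W]] W G]])
  have G12: "partial_Z 1 2 ?G W =
      \<Delta> \<alpha> W * S (D 1 2 g) W + \<i> / 2 * \<alpha> * (\<Delta> (\<alpha> - 1) W * y 1 2 W) * S g W" if W: "W \<in> siegel_H" for W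
    by (rule has_partial_Z_imp[OF has_partial_Z_cong[OF has_partial_Z_mult[OF p\<Delta>(3)[OF W] pS[OF g W]] W G]])
  have G1122: "partial_Z 1 1 (partial_Z 2 2 ?G) Z =
      (\<Delta> \<alpha> Z * S (D 1 1 (D 2 2 g)) Z + - \<i> / 2 * \<alpha> * (\<Delta> (\<alpha> - 1) Z * y 2 2 Z) * S (D 2 2 g) Z) +
      (- \<i> / 2 * \<alpha> * (\<Delta> (\<alpha> - 1) Z * y 1 1 Z) * S (D 1 1 g) Z +
        - \<i> / 2 * \<alpha> * (\<Delta> (\<alpha> - 1) Z * (- \<i> / 2) +
          (- \<i> / 2 * of_real (\<alpha> - 1) * (\<Delta> (\<alpha> - 1 - 1) Z * y 2 2 Z)) * y 1 1 Z) * S g Z)"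
    by (rule has_partial_Z_imp, rule has_partial_Z_cong[OF _ Z G22])
       (intro has_partial_Z_add has_partial_Z_mult has_partial_Z_cmult p\<Delta>[OF Z] pS[OF _ Z] py g sD, assumption)
  have G1212: "partial_Z 1 2 (partial_Z 1 2 ?G) Z =
      (\<Delta> \<alpha> Z * S (D 1 2 (D 1 2 g)) Z + \<i> / 2 * \<alpha> * (\<Delta> (\<alpha> - 1) Z * y 1 2 Z) * S (D 1 2 g) Z) +
      (\<i> / 2 * \<alpha> * (\<Delta> (\<alpha> - 1) Z * y 1 2 Z) * S (D 1 2 g) Z +
        \<i> / 2 * \<alpha> * (\<Delta> (\<alpha> - 1) Z * (- \<i> / 4) +
          (\<i> / 2 * of_real (\<alpha> - 1) * (\<Delta> (\<alpha> - 1 - 1) Z * y 1 2 Z)) * y 1 2 Z) * S g Z)"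
    by (rule has_partial_Z_imp, rule has_partial_Z_cong[OF _ Z G12])
       (intro has_partial_Z_add has_partial_Z_mult has_partial_Z_cmult p\<Delta>[OF Z] pS[OF _ Z] py g sD, assumption)
  define d where "d = det (Im_mat Z)"
  have Zsym: "Z $ 2 $ 1 = Z $ 1 $ 2" and d0: "d > 0"
    using Z posdef_det_pos unfolding mem_siegel_H_iff d_def by auto
  have d: "complex_of_real d = y 1 1 Z * y 2 2 Z - y 1 2 Z * y 1 2 Z"
    by (simp add: d_def y_def det_2 Zsym)
  have \<Delta>1: "\<Delta> (\<alpha> - 1) Z = \<Delta> \<alpha> Z / d" "\<Delta> (\<alpha> - 1 - 1) Z = \<Delta> \<alpha> Z / d / d"
    using d0 powr_diff[of d "\<alpha> - 1" 1] powr_diff[of d \<alpha> 1] by (simp_all add: \<Delta>_def d_def)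
  have \<Delta>0: "\<Delta> \<alpha> Z \<noteq> 0" using d0 by (simp add: \<Delta>_def d_def)
  have inv: "complex_of_real (det (Im_mat Z) powr (1/2 - real k)) = inverse (\<Delta> \<alpha> Z)"
    using powr_minus[of d \<alpha>] by (simp add: \<Delta>_def \<alpha>_def d_def flip: of_real_inverse)
  \<comment> \<open>\<open>Q\<close> is the determinant operator applied to \<open>?G\<close>,
    divided by the outer power of \<open>det(Y)\<close>.\<close>
  define Q where "Q = S (D 1 1 (D 2 2 g)) Z - S (D 1 2 (D 1 2 g)) Z
     - \<i> * \<alpha> / 2 / d * (y 2 2 Z * S (D 2 2 g) Z + y 1 1 Z * S (D 1 1 g) Z + 2 * (y 1 2 Z * S (D 1 2 g) Z))
     - \<alpha> * (\<alpha> + 1/2) / 4 / d * S g Z"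
  have "maass_op k h Z = -4 * Q"
  proof -
    have "\<Delta> \<alpha> Z * Q = det_partial_Z ?G Z"
      unfolding det_partial_Z_def partial_Z_commute G1122 G1212 \<Delta>1 Q_def
      using maass_bracket_eq[OF d, where a = \<alpha>] d0 by simp
    then show ?thesis
      using \<Delta>0 unfolding maass_op_def inv by (simp add: field_simps)
  qed
  moreover have "((\<lambda>T. g T * of_real (maass_weight k T (Im_mat Z)) * cexp T Z) has_sum (-4 * Q)) \<Lambda>"
  proof -
    have hs: "((\<lambda>T. c T * cexp T Z) has_sum S c Z) \<Lambda>" if "summable_coeffs \<Lambda> c" for c
      using that Z unfolding summable_coeffs_def S_def fourier_series_def by auto
    have "((\<lambda>T. -4 * (D 1 1 (D 2 2 g) T * cexp T Z - D 1 2 (D 1 2 g) T * cexp T Z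
     - \<i> * \<alpha> / 2 / d * (y 2 2 Z * (D 2 2 g T * cexp T Z) + y 1 1 Z * (D 1 1 g T * cexp T Z) + 2 * (y 1 2 Z * (D 1 2 g T * cexp T Z)))
     - \<alpha> * (\<alpha> + 1/2) / 4 / d * (g T * cexp T Z))) has_sum (-4 * Q)) \<Lambda>"
      unfolding Q_def by (intro has_sum_cmult_right has_sum_add has_sum_diff hs sD g)
    moreover have "-4 * (D 1 1 (D 2 2 g) T * cexp T Z - D 1 2 (D 1 2 g) T * cexp T Z
     - \<i> * \<alpha> / 2 / d * (y 2 2 Z * (D 2 2 g T * cexp T Z) + y 1 1 Z * (D 1 1 g T * cexp T Z) + 2 * (y 1 2 Z * (D 1 2 g T * cexp T Z)))
     - \<alpha> * (\<alpha> + 1/2) / 4 / d * (g T * cexp T Z)) = g T * of_real (maass_weight k T (Im_mat Z)) * cexp T Z"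
      if "T \<in> \<Lambda>" for T
    proof -
      have sym: "T $ 2 $ 1 = T $ 1 $ 2" using that \<Lambda> by (auto simp: posdef_iff)
      have "real k = \<alpha> + 1/2" by (simp add: \<alpha>_def)
      \<comment> \<open>Multiplication by \<open>-4\<close> turns \<open>(2 * pi * \<i>)^2\<close>
        into \<open>16 * pi^2\<close>, the product of \<open>- \<i> * \<alpha> / 2\<close> and
        \<open>2 * pi * \<i>\<close> into \<open>- 4 * pi * \<alpha>\<close>, and cancels the last
        \<open>1/4\<close>.\<close>
      then have w: "maass_weight k T (Im_mat Z) = 16 * pi\<^sup>2 * (T $ 1 $ 1 * T $ 2 $ 2 - T $ 1 $ 2 * T $ 1 $ 2)
        - (4 * pi * \<alpha> * (T $ 1 $ 1 * Im (Z $ 1 $ 1) + 2 * (T $ 1 $ 2 * Im (Z $ 1 $ 2)) + T $ 2 $ 2 * Im (Z $ 2 $ 2))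
           - \<alpha> * (\<alpha> + 1/2)) / d"
        unfolding maass_weight_def d_def[symmetric]
        by (simp add: trace_mult_2 det_2[of T] sym Zsym add_ac)
      show ?thesis
        unfolding w D_def y_def using d0
        by (simp add: field_simps power2_eq_square)
    qed
    ultimately show ?thesis
      by (simp cong: has_sum_cong)
  qed
  ultimately show ?thesis by simp
qed

section \<open>Fourier expansions of cusp forms\<close>

text \<open>The mean of the powers \<open>w x ^ n\<close> over \<open>n < N\<close> is 1 if
  \<open>w x = 1\<close> and 0 for every other \<open>N\<close>-th root of unity. All
  \<open>N\<close> series have the same sum, so averaging keeps it and deletes the remaining
  terms.\<close>

lemma has_sum_average:
  fixes f w :: "'a \<Rightarrow> complex"
  assumes N: "0 < (N::nat)" and hs: "\<And>n. n < N \<Longrightarrow> ((\<lambda>x. f x * w x ^ n) has_sum s) A"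
    and w: "\<And>x. x \<in> A \<Longrightarrow> w x ^ N = 1"
  shows "(f has_sum s) {x \<in> A. w x = 1}"
proof -
  have "((\<lambda>x. \<Sum>n<m. f x * w x ^ n) has_sum (of_nat m * s)) A" if "m \<le> N" for m
    using that
  proof (induction m)
    case (Suc m)
    then have "((\<lambda>x. (\<Sum>n<m. f x * w x ^ n) + f x * w x ^ m) has_sum (of_nat m * s + s)) A"
      by (intro has_sum_add hs) auto
    then show ?case by (simp add: algebra_simps)
  qed simp
  from has_sum_cmult_right[OF this[OF order_refl], of "1 / of_nat N"]
  have "((\<lambda>x. 1 / of_nat N * (\<Sum>n<N. f x * w x ^ n)) has_sum s) A"
    using N by simp
  also have "?this \<longleftrightarrow> (f has_sum s) {x \<in> A. w x = 1}"
  proof (rule has_sum_cong_neutral)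
    fix x assume "x \<in> A \<inter> {x \<in> A. w x = 1}"
    then show "1 / of_nat N * (\<Sum>n<N. f x * w x ^ n) = f x" using N by simp
  next
    fix x assume "x \<in> A - {x \<in> A. w x = 1}"
    then show "1 / of_nat N * (\<Sum>n<N. f x * w x ^ n) = 0"
      using w[of x] by (simp add: sum_distrib_left[symmetric] geometric_sum)
  qed auto
  finally show ?thesis .
qed

text \<open>Averaging over the translates \<open>Z + nX\<close>, \<open>n < N\<close>, removes the frequencies that are not integral
  on \<open>X\<close>; uniqueness of Fourier coefficients is not needed.\<close>

lemma has_sum_cexp_periodic:
  assumes hs: "\<And>Z. Z \<in> siegel_H \<Longrightarrow> ((\<lambda>T. c T * cexp T Z) has_sum h Z) A"
    and per: "\<And>Z. Z \<in> siegel_H \<Longrightarrow> h (Z + complex_mat X 0) = h Z"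
    and sym: "X $ 2 $ 1 = X $ 1 $ 2"
    and N: "0 < N" and den: "\<And>T. T \<in> A \<Longrightarrow> real N * trace (T ** X) \<in> \<int>"
    and Z: "Z \<in> siegel_H"
  shows "((\<lambda>T. c T * cexp T Z) has_sum h Z) {T \<in> A. trace (T ** X) \<in> \<int>}"
proof -
  define w where "w T = exp (of_real (2 * pi * trace (T ** X)) * \<i>)" for T
  have w1: "exp (of_real (2 * pi * x) * \<i>) = 1 \<longleftrightarrow> x \<in> \<int>" for x
    by (auto simp: exp_eq_1 Ints_def field_simps)
  have wN: "w T ^ n = exp (of_real (2 * pi * (real n * trace (T ** X))) * \<i>)" for n T
    by (simp add: w_def exp_of_nat_mult[symmetric] mult_ac)
  have step: "Z + real n *\<^sub>R complex_mat X 0 \<in> siegel_H \<and> h (Z + real n *\<^sub>R complex_mat X 0) = h Z" for n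
  proof (induction n)
    case (Suc n)
    let ?Z = "Z + real n *\<^sub>R complex_mat X 0"
    have "Im_mat (?Z + complex_mat X 0) = Im_mat ?Z" by (simp add: vec_eq_iff)
    then have "?Z + complex_mat X 0 \<in> siegel_H \<and> h (?Z + complex_mat X 0) = h Z"
      using Suc per[of ?Z] sym by (auto simp: mem_siegel_H_iff)
    moreover have "Z + real (Suc n) *\<^sub>R complex_mat X 0 = ?Z + complex_mat X 0" by (simp add: algebra_simps)
    ultimately show ?case by (simp only:)
  qed (use Z in simp)
  have cw: "cexp T (Z + real n *\<^sub>R complex_mat X 0) = cexp T Z * w T ^ n" for T n
    unfolding cexp_add_scaleR wN
    by (intro arg_cong2[where f = "(*)"] arg_cong[where f = exp] refl)
       (simp add: trace_mult_2 complex_eq_iff algebra_simps)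
  have "((\<lambda>T. c T * cexp T Z) has_sum h Z) {T \<in> A. w T = 1}"
  proof (rule has_sum_average[OF N])
    fix n
    show "((\<lambda>T. c T * cexp T Z * w T ^ n) has_sum h Z) A"
      using hs[of "Z + real n *\<^sub>R complex_mat X 0"] step[of n] unfolding cw by (simp add: mult.assoc)
  next
    fix T assume "T \<in> A"
    then show "w T ^ N = 1" unfolding wN w1 by (rule den)
  qed
  then show ?thesis unfolding w_def w1 .
qed

section \<open>Translations in the symplectic group and the expansion over half-integral
  \<open>T\<close>\<close>

lemma sum_UNIV_Plus: "(\<Sum>x\<in>UNIV. f x) = (\<Sum>x\<in>UNIV. f (Inl x)) + (\<Sum>x\<in>UNIV. f (Inr x))"
  for f :: "'a::finite + 'b::finite \<Rightarrow> 'c::comm_monoid_add"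
  unfolding UNIV_Plus_UNIV[symmetric] by (subst sum.Plus) auto

definition translation :: "int^2^2 \<Rightarrow> int_mat4" where
  "translation B = (\<chi> p q. case (p, q) of
      (Inl i, Inl j) \<Rightarrow> (if i = j then 1 else 0)
    | (Inl i, Inr j) \<Rightarrow> B $ i $ j
    | (Inr i, Inl j) \<Rightarrow> 0
    | (Inr i, Inr j) \<Rightarrow> (if i = j then 1 else 0))"

lemma blk_translation [simp]:
  "blk_a (translation B) = mat 1" "blk_b (translation B) = B"
  "blk_c (translation B) = 0" "blk_d (translation B) = mat 1"
  by (simp_all add: blk_a_def blk_b_def blk_c_def blk_d_def translation_def vec_eq_iff mat_def)

lemma translation_in_Gamma_inf:
  assumes "transpose B = B"
  shows "translation B \<in> Gamma_inf"
proof -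
  have B: "B $ 2 $ 1 = B $ 1 $ 2" using arg_cong[OF assms, of "\<lambda>M. M $ 1 $ 2"] by (simp add: transpose_def)
  have "transpose (translation B) ** sympl_J ** translation B = sympl_J"
    by (simp add: vec_eq_iff split_sum_all forall_2 matrix_matrix_mult_def transpose_def
        sum_UNIV_Plus sum_2 translation_def sympl_J_def B)
  then show ?thesis by (simp add: Gamma_inf_def Sp2Z_def)
qed

lemma cint_0 [simp]: "cint 0 = 0" and cint_mat_1 [simp]: "cint (mat 1) = mat 1"
  by (simp_all add: cint_def vec_eq_iff mat_def)

lemma moebius_translation: "moebius (translation B) Z = Z + cint B"
proof -
  have "matrix_inv (mat 1 :: complex^2^2) = mat 1"
    unfolding matrix_inv_def by (rule some_equality) simp_all
  then show ?thesis by (simp add: moebius_def)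
qed

lemma aut_factor_translation: "aut_factor (translation B) Z = 1"
  by (simp add: aut_factor_def)

lemma translation_0: "translation 0 = mat 1"
  by (simp add: vec_eq_iff split_sum_all forall_2 translation_def mat_def)

text \<open>Cuspidality at the identity matrix gives an expansion with denominators
  \<open>N\<close>. Invariance under the translations in \<open>Gamma_inf\<close> removes them, one
  basis direction of the symmetric matrices at a time.\<close>

lemma cusp_form_fourier_expansion:
  assumes \<Gamma>: "Gamma_inf \<subseteq> \<Gamma>" and h: "cusp_form \<Gamma> k h"
  obtains c where "\<And>Z. Z \<in> siegel_H \<Longrightarrow>
    ((\<lambda>T. c T * cexp T Z) has_sum h Z) {T. posdef T \<and> half_integral T}"
proof -
  have "mat 1 \<in> carrier Sp2Z"
    using translation_in_Gamma_inf[of 0] by (simp add: translation_0 Gamma_inf_def transpose_def vec_eq_iff)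
  with h obtain N c where N: "N > 0" and c: "\<And>Z. Z \<in> siegel_H \<Longrightarrow>
      ((\<lambda>T. c T * exp (2 * pi * \<i> * trace (complex_mat T 0 ** Z)))
           has_sum (h (moebius (mat 1) Z) / aut_factor (mat 1) Z ^ k))
        {T. posdef T \<and> half_integral (real N *\<^sub>R T)}"
    unfolding cusp_form_def by blast
  have hs: "((\<lambda>T. c T * cexp T Z) has_sum h Z) {T. posdef T \<and> half_integral (real N *\<^sub>R T)}"
    if "Z \<in> siegel_H" for Z
    using c[OF that] unfolding translation_0[symmetric] moebius_translation aut_factor_translation
    by (simp add: cexp_def)
  have per: "h (Z + complex_mat (sym_mat (real_of_int p, real_of_int q, real_of_int r)) 0) = h Z" if "Z \<in> siegel_H" for Z p q r
  proof -
    define B :: "int^2^2" where "B = vector [vector [p, q], vector [q, r]]"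
    have "translation B \<in> \<Gamma>"
      using translation_in_Gamma_inf[of B] \<Gamma> by (auto simp: B_def transpose_def vec_eq_iff forall_2)
    then have "h (moebius (translation B) Z) = aut_factor (translation B) Z ^ k * h Z"
      using h that unfolding cusp_form_def has_weight_def by blast
    moreover have "cint B = complex_mat (sym_mat (real_of_int p, real_of_int q, real_of_int r)) 0"
      by (simp add: B_def cint_def vec_eq_iff forall_2 complex_eq_iff)
    ultimately show ?thesis by (simp add: moebius_translation aut_factor_translation)
  qed
  have den: "real N * T $ 1 $ 1 \<in> \<int>" "real N * T $ 2 $ 2 \<in> \<int>" "real N * (T $ 1 $ 2 + T $ 2 $ 1) \<in> \<int>"
    if "T \<in> {T. posdef T \<and> half_integral (real N *\<^sub>R T)}" for T
    using that by (auto simp: half_integral_def posdef_iff algebra_simps)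
  \<comment> \<open>The three directions enforce integrality of \<open>T $ 1 $ 1\<close>, then
    \<open>2 * T $ 1 $ 2\<close>, then \<open>T $ 2 $ 2\<close>.\<close>
  have 1: "((\<lambda>T. c T * cexp T Z) has_sum h Z)
      {T \<in> {T. posdef T \<and> half_integral (real N *\<^sub>R T)}. trace (T ** sym_mat (1, 0, 0)) \<in> \<int>}" (is "(_ has_sum _) ?A")
    if "Z \<in> siegel_H" for Z
    by (rule has_sum_cexp_periodic[OF hs _ _ N _ that])
       (use per[of _ 1 0 0] den in \<open>auto simp: trace_mult_sym_mat\<close>)
  have 2: "((\<lambda>T. c T * cexp T Z) has_sum h Z) {T \<in> ?A. trace (T ** sym_mat (0, 1, 0)) \<in> \<int>}" (is "(_ has_sum _) ?B")
    if "Z \<in> siegel_H" for Z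
    by (rule has_sum_cexp_periodic[OF 1 _ _ N _ that])
       (use per[of _ 0 1 0] den in \<open>auto simp: trace_mult_sym_mat\<close>)
  have 3: "((\<lambda>T. c T * cexp T Z) has_sum h Z) {T \<in> ?B. trace (T ** sym_mat (0, 0, 1)) \<in> \<int>}" (is "(_ has_sum _) ?C")
    if "Z \<in> siegel_H" for Z
    by (rule has_sum_cexp_periodic[OF 2 _ _ N _ that])
       (use per[of _ 0 0 1] den in \<open>auto simp: trace_mult_sym_mat\<close>)
  have "?C = {T. posdef T \<and> half_integral T}"
  proof (intro subset_antisym subsetI)
    fix T assume T: "T \<in> ?C"
    then have "posdef T" by simp
    then have "T $ 2 $ 1 = T $ 1 $ 2" "transpose T = T"
      unfolding posdef_iff by (simp_all add: transpose_def vec_eq_iff forall_2)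
    with T show "T \<in> {T. posdef T \<and> half_integral T}"
      by (auto simp: trace_mult_sym_mat half_integral_def)
  next
    fix T assume "T \<in> {T. posdef T \<and> half_integral T}"
    then have T: "posdef T" "T $ 1 $ 1 \<in> \<int>" "T $ 2 $ 2 \<in> \<int>" "2 * T $ 1 $ 2 \<in> \<int>" "T $ 2 $ 1 = T $ 1 $ 2"
      by (auto simp: half_integral_def posdef_iff)
    then show "T \<in> ?C"
      using Ints_mult[OF Ints_of_nat[of N] T(2)] Ints_mult[OF Ints_of_nat[of N] T(3)] Ints_mult[OF Ints_of_nat[of N] T(4)]
      by (simp add: trace_mult_sym_mat half_integral_def transpose_scalar posdef_def mult.left_commute)
  qed
  with 3 show ?thesis by (intro that[of c]) simp
qed

section \<open>Orthogonality of characters on the unit cube and extraction of coefficients\<close>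

lemma has_integral_exp_int:
  assumes "n \<in> \<int>"
  shows "((\<lambda>x::real. exp (of_real (2 * pi * (n * x)) * \<i>)) has_integral (if n = 0 then 1 else 0)) {0..1}"
proof (cases "n = 0")
  case False
  define a where "a = of_real (2 * pi * n) * \<i>"
  have a: "a \<noteq> 0" using False by (simp add: a_def)
  have "((\<lambda>x::real. exp (x *\<^sub>R a)) has_integral exp (1 *\<^sub>R a) / a - exp (0 *\<^sub>R a) / a) {0..1}"
  proof (rule fundamental_theorem_of_calculus)
    fix x :: real
    have "((\<lambda>x. exp (x *\<^sub>R a) / a) has_vector_derivative exp (x *\<^sub>R a) * a / a) (at x within {0..1})"
      by (intro has_vector_derivative_divide exp_scaleR_has_vector_derivative_right)
    then show "((\<lambda>x. exp (x *\<^sub>R a) / a) has_vector_derivative exp (x *\<^sub>R a)) (at x within {0..1})"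
      using a by simp
  qed simp
  moreover have "exp a = 1"
    using assms unfolding a_def by (auto simp: exp_eq_1 Ints_def field_simps)
  then have "exp (1 *\<^sub>R a) / a - exp (0 *\<^sub>R a) / a = (if n = 0 then 1 else 0)" using False by simp
  moreover have "x *\<^sub>R a = of_real (2 * pi * (n * x)) * \<i>" for x
    by (simp add: a_def scaleR_conv_of_real)
  ultimately show ?thesis by (simp only:)
qed (use has_integral_const_real[of "1::complex" 0 1] in simp)

lemma integral_exp_int_cube:
  assumes "l \<in> \<int>" "m \<in> \<int>" "n \<in> \<int>"
  shows "integral (cbox (0, 0, 0) (1, 1, 1)) (\<lambda>(a, b, c). exp (of_real (2 * pi * (l * a + m * b + n * c)) * \<i>))
     = (if l = 0 \<and> m = 0 \<and> n = 0 then 1 else 0)"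
proof -
  define e where "e r x = exp (of_real (2 * pi * (r * x)) * \<i>)" for r x :: real
  have i: "integral {0..1} (e r) = (if r = 0 then 1 else 0)" if "r \<in> \<int>" for r
    using has_integral_exp_int[OF that] unfolding e_def by (rule integral_unique)
  have ce: "continuous_on S (\<lambda>x. e r (g x))" if "continuous_on S g" for r g and S :: "'b::topological_space set"
    unfolding e_def using that by (intro continuous_intros)
  have "(\<lambda>(a, b, c). exp (of_real (2 * pi * (l * a + m * b + n * c)) * \<i>)) =
      (\<lambda>y. e l (fst y) * (e m (fst (snd y)) * e n (snd (snd y))))"
    by (auto simp: e_def exp_add[symmetric] algebra_simps intro!: arg_cong[where f = exp])
  moreover have "integral (cbox (0, 0, 0) (1, 1, 1)) (\<lambda>y. e l (fst y) * (e m (fst (snd y)) * e n (snd (snd y))))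
    = integral {0..1} (\<lambda>a. e l a * integral (cbox (0, 0) (1, 1)) (\<lambda>z. e m (fst z) * e n (snd z)))"
    by (subst integral_prod_continuous, intro continuous_intros ce) simp
  moreover have "integral (cbox (0, 0) (1, 1)) (\<lambda>z. e m (fst z) * e n (snd z)) =
      integral {0..1} (\<lambda>b. e m b * integral {0..1} (e n))"
    by (subst integral_prod_continuous, intro continuous_intros ce) simp
  ultimately show ?thesis using assms by (simp add: i)
qed

lemma cexp_complex_mat: "cexp T (complex_mat X Y) =
    exp (of_real (- 2 * pi * trace (T ** Y))) * exp (of_real (2 * pi * trace (T ** X)) * \<i>)"
proof -
  have "trace (complex_mat T 0 ** complex_mat X Y) = of_real (trace (T ** X)) + \<i> * of_real (trace (T ** Y))"
    by (simp add: trace_mult_2 complex_eq_iff)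
  then show ?thesis
    unfolding cexp_def exp_add[symmetric] by (intro arg_cong[where f = exp]) (simp add: algebra_simps)
qed

text \<open>The norms of the terms do not depend on \<open>x\<close>, so absolute convergence at
  \<open>x = 0\<close> gives uniform convergence on the cube. Integrating termwise, orthogonality
  leaves only \<open>T0\<close>.\<close>

lemma fourier_coeff_has_sum:
  assumes \<Lambda>: "\<Lambda> \<subseteq> {T. posdef T \<and> half_integral T}" and T0: "T0 \<in> \<Lambda>"
    and hs: "\<And>x. ((\<lambda>T. c T * cexp T (complex_mat (sym_mat x) Y)) has_sum F (complex_mat (sym_mat x) Y)) \<Lambda>"
  shows "fourier_coeff F T0 Y = c T0 * exp (of_real (- 2 * pi * trace (T0 ** Y)))"
proof -
  define \<phi> where "\<phi> T x = c T * cexp T (complex_mat (sym_mat x) Y) * exp (- 2 * pi * \<i> * trace (T0 ** sym_mat x))" for T x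
  define f where "f x = F (complex_mat (sym_mat x) Y) * exp (- 2 * pi * \<i> * trace (T0 ** sym_mat x))" for x
  let ?Q = "cbox (0, 0, 0) (1, 1, 1) :: (real \<times> real \<times> real) set"
  have \<phi>: "\<phi> T x = c T * exp (of_real (- 2 * pi * trace (T ** Y))) *
      exp (of_real (2 * pi * (trace (T ** sym_mat x) - trace (T0 ** sym_mat x))) * \<i>)" for T x
    unfolding \<phi>_def cexp_complex_mat mult.assoc exp_add[symmetric]
    by (intro arg_cong2[where f = "(*)"] arg_cong[where f = exp] refl) (simp add: algebra_simps)
  have hs': "((\<lambda>T. \<phi> T x) has_sum f x) \<Lambda>" for x
    unfolding \<phi>_def f_def by (intro has_sum_cmult_left hs)
  have n: "norm (\<phi> T x) = norm (\<phi> T 0)" for T x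
    unfolding \<phi> by (simp add: norm_mult)
  have u: "uniform_limit ?Q (\<lambda>X x. \<Sum>T\<in>X. \<phi> T x) f (finite_subsets_at_top \<Lambda>)"
  proof (rule Weierstrass_m_test_general')
    show "(\<lambda>T. norm (\<phi> T 0)) summable_on \<Lambda>"
      by (rule summable_on_iff_abs_summable_on_complex[THEN iffD1, OF has_sum_imp_summable[OF hs']])
  qed (use n hs' in auto)
  have c\<phi>: "continuous_on S (\<phi> T)" for T S
    unfolding \<phi> trace_mult_sym_mat by (intro continuous_intros)
  have c\<phi>': "continuous_on ?Q (\<lambda>x. \<Sum>T\<in>X. \<phi> T x)" for X
    by (intro continuous_on_sum c\<phi>)
  obtain I J where I: "\<And>X. ((\<lambda>x. \<Sum>T\<in>X. \<phi> T x) has_integral I X) ?Q" and J: "(f has_integral J) ?Q"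
    and lim: "(I \<longlongrightarrow> J) (finite_subsets_at_top \<Lambda>)"
    by (rule uniform_limit_integral_cbox[OF u c\<phi>']) auto
  have i\<phi>: "integral ?Q (\<phi> T) = (if T = T0 then c T0 * exp (of_real (- 2 * pi * trace (T0 ** Y))) else 0)"
    if "T \<in> \<Lambda>" for T
  proof -
    let ?l = "T $ 1 $ 1 - T0 $ 1 $ 1" and ?m = "(T $ 1 $ 2 + T $ 2 $ 1) - (T0 $ 1 $ 2 + T0 $ 2 $ 1)"
      and ?n = "T $ 2 $ 2 - T0 $ 2 $ 2"
    have sym: "T $ 2 $ 1 = T $ 1 $ 2" "T0 $ 2 $ 1 = T0 $ 1 $ 2"
      using that T0 \<Lambda> by (auto simp: posdef_iff)
    have "?l \<in> \<int>" "?n \<in> \<int>" "2 * T $ 1 $ 2 - 2 * T0 $ 1 $ 2 \<in> \<int>"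
      using subsetD[OF \<Lambda> that] subsetD[OF \<Lambda> T0] by (auto simp: half_integral_def intro!: Ints_diff)
    moreover have "?m = 2 * T $ 1 $ 2 - 2 * T0 $ 1 $ 2" using sym by simp
    ultimately have int: "?l \<in> \<int>" "?m \<in> \<int>" "?n \<in> \<int>" by (simp_all only:)
    have "\<phi> T = (\<lambda>y. c T * exp (of_real (- 2 * pi * trace (T ** Y))) *
        (case y of (a, b, c) \<Rightarrow> exp (of_real (2 * pi * (?l * a + ?m * b + ?n * c)) * \<i>)))"
      unfolding \<phi> trace_mult_sym_mat by (auto simp: fun_eq_iff algebra_simps)
    then have "integral ?Q (\<phi> T) = c T * exp (of_real (- 2 * pi * trace (T ** Y))) *
       (if ?l = 0 \<and> ?m = 0 \<and> ?n = 0 then 1 else 0)"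
      by (simp only: integral_mult_right integral_exp_int_cube[OF int])
    also have "?l = 0 \<and> ?m = 0 \<and> ?n = 0 \<longleftrightarrow> T = T0"
      using sym by (auto simp: vec_eq_iff forall_2)
    finally show ?thesis by simp
  qed
  have I': "I X = (\<Sum>T\<in>X. integral ?Q (\<phi> T))" if "finite X" for X
    using integral_sum[OF that, of \<phi> ?Q] integrable_continuous[OF c\<phi>] integral_unique[OF I[of X]] by simp
  have "(sum (\<lambda>T. integral ?Q (\<phi> T)) \<longlongrightarrow> J) (finite_subsets_at_top \<Lambda>)"
    by (rule Lim_transform_eventually[OF lim])
       (use I' in \<open>auto intro: eventually_finite_subsets_at_top_weakI\<close>)
  then have "((\<lambda>T. integral ?Q (\<phi> T)) has_sum J) \<Lambda>" by (simp add: has_sum_def)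
  moreover have "((\<lambda>T. integral ?Q (\<phi> T)) has_sum (c T0 * exp (of_real (- 2 * pi * trace (T0 ** Y))))) \<Lambda>"
    by (rule has_sum_finite_neutralI[of "{T0}"]) (use T0 i\<phi> in auto)
  ultimately have J': "J = c T0 * exp (of_real (- 2 * pi * trace (T0 ** Y)))"
    by (rule has_sum_unique)
  have "continuous_on ?Q f"
    by (rule uniform_limit_theorem[OF _ u]) (use c\<phi>' in auto)
  \<comment> \<open>The uniform limit is continuous, so the Lebesgue integral in
    \<open>fourier_coeff\<close> agrees with the gauge integral \<open>J\<close>.\<close>
  then have "set_integrable lborel ?Q f"
    unfolding set_integrable_def by (intro borel_integrable_compact compact_cbox)
  then have "(LINT x:?Q|lborel. f x) = J"
    using set_borel_integral_eq_integral(2) integral_unique[OF J] by metis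
  moreover have "{0..1} \<times> {0..1} \<times> {0..1} = ?Q"
    by (simp add: cbox_Pair_eq)
  moreover have "half_integral T0" using T0 \<Lambda> by auto
  ultimately show ?thesis
    by (simp add: fourier_coeff_def f_def J')
qed

section \<open>Sturm's operator\<close>

lemma mem_siegel_H_complex_mat: "posdef Y \<Longrightarrow> complex_mat (sym_mat x) Y \<in> siegel_H"
proof -
  assume Y: "posdef Y"
  moreover have "Im_mat (complex_mat (sym_mat x) Y) = Y" by (simp add: vec_eq_iff)
  moreover have "sym_mat x $ 2 $ 1 = sym_mat x $ 1 $ 2" by (cases x) simp
  ultimately show ?thesis by (simp add: mem_siegel_H_iff posdef_iff)
qed

text \<open>The weight depends on \<open>Z\<close> only through \<open>Y\<close>; for fixed
  \<open>Y\<close> the image is again a series in the characters, now with coefficients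
  \<open>c T * maass_weight k T Y\<close>.\<close>

lemma fourier_coeff_maass_op:
  assumes hs: "\<And>Z. Z \<in> siegel_H \<Longrightarrow> ((\<lambda>T. c T * cexp T Z) has_sum h Z) {T. posdef T \<and> half_integral T}"
    and T: "posdef T" "half_integral T" and Y: "posdef Y"
  shows "fourier_coeff (maass_op k h) T Y =
    c T * of_real (maass_weight k T Y * exp (- 2 * pi * trace (T ** Y)))"
proof -
  let ?L = "{T. posdef T \<and> half_integral T}"
  have sc: "summable_coeffs ?L c"
    unfolding summable_coeffs_def using hs by (blast intro: has_sum_imp_summable)
  have h: "h Z = fourier_series ?L c Z" if "Z \<in> siegel_H" for Z
    using infsumI[OF hs[OF that]] by (simp add: fourier_series_def)
  have "fourier_coeff (maass_op k h) T Y =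
      c T * of_real (maass_weight k T Y) * exp (of_real (- 2 * pi * trace (T ** Y)))"
  proof (rule fourier_coeff_has_sum)
    fix x
    let ?Z = "complex_mat (sym_mat x) Y"
    have "Im_mat ?Z = Y" by (simp add: vec_eq_iff)
    then show "((\<lambda>T. c T * of_real (maass_weight k T Y) * cexp T ?Z) has_sum maass_op k h ?Z) ?L"
      using has_sum_maass_op[OF _ sc h mem_siegel_H_complex_mat[OF Y], of k x] by auto
  qed (use T in auto)
  then show ?thesis by (simp only: exp_of_real[symmetric] of_real_mult mult.assoc)
qed

text \<open>The Fourier coefficient and Sturm's kernel each contribute
  \<open>exp (- 2 * pi * trace (T ** Y))\<close>; together they form the exponential for
  \<open>4 * pi * T\<close>. The hypothesis on \<open>s\<close> is the convergence condition
  \<open>\<alpha> + s > 1/2\<close>.\<close>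

lemma has_bochner_integral_sturm_integrand:
  assumes hs: "\<And>Z. Z \<in> siegel_H \<Longrightarrow> ((\<lambda>T. c T * cexp T Z) has_sum h Z) {T. posdef T \<and> half_integral T}"
    and T: "posdef T" "half_integral T" and s: "real k + s > 1"
  shows "has_bochner_integral lborel (\<lambda>y. indicator pos_cone y *\<^sub>R sturm_integrand (k + 2) (maass_op k h) T s y)
    (c T * of_real (det T powr (real k + 1/2) * (s * (s - 1/2) *
       (cone_gamma (real k - 1/2 + s) * (16 * pi\<^sup>2 * det T) powr - (real k - 1/2 + s)))))"
proof -
  define \<alpha> where "\<alpha> = real k - 1/2"
  let ?S = "(4 * pi) *\<^sub>R T"
  have S: "posdef ?S" using T(1) by (rule posdef_scaleR) simp
  have dS: "det ?S = 16 * pi\<^sup>2 * det T" by (simp add: power_mult_distrib)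
  have dT: "det T > 0" using T(1) by (rule posdef_det_pos)
  have "has_bochner_integral lborel (\<lambda>y. c T * of_real (det T powr (real k + 1/2) * (indicator pos_cone y *\<^sub>R
      ((det ?S - (\<alpha> * trace (?S ** sym_mat y) - \<alpha> * (\<alpha> + 1/2)) / det (sym_mat y)) *
       (exp (- trace (?S ** sym_mat y)) * det (sym_mat y) powr (\<alpha> + s - 1/2))))))
    (c T * of_real (det T powr (real k + 1/2) * (s * (s - 1/2) * (cone_gamma (\<alpha> + s) * det ?S powr - (\<alpha> + s)))))"
    by (rule has_bochner_integral_mult_right, rule has_bochner_integral_of_real,
      rule has_bochner_integral_mult_right, rule has_bochner_integral_pos_cone_maass[OF S])
      (use s in \<open>simp add: \<alpha>_def\<close>)
  moreover have "c T * of_real (det T powr (real k + 1/2) * (indicator pos_cone y *\<^sub>R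
      ((det ?S - (\<alpha> * trace (?S ** sym_mat y) - \<alpha> * (\<alpha> + 1/2)) / det (sym_mat y)) *
       (exp (- trace (?S ** sym_mat y)) * det (sym_mat y) powr (\<alpha> + s - 1/2)))))
     = indicator pos_cone y *\<^sub>R sturm_integrand (k + 2) (maass_op k h) T s y" for y
  proof (cases "y \<in> pos_cone")
    case True
    let ?Y = "sym_mat y"
    have Y: "posdef ?Y" using True by (simp add: pos_cone_def)
    have dY: "det ?Y > 0" using Y by (rule posdef_det_pos)
    have w: "maass_weight k T ?Y = det ?S - (\<alpha> * trace (?S ** ?Y) - \<alpha> * (\<alpha> + 1/2)) / det ?Y"
    proof -
      have "4 * pi * (real k - 1/2) * t - (real k - 1/2) * real k = \<alpha> * (4 * pi * t) - \<alpha> * (\<alpha> + 1/2)" for t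
        by (simp add: \<alpha>_def)
      then show ?thesis by (simp only: maass_weight_def dS trace_scaleR_mult)
    qed
    have e: "exp (- trace (?S ** ?Y)) = exp (- 2 * pi * trace (T ** ?Y)) * exp (- 2 * pi * trace (T ** ?Y))"
      unfolding trace_scaleR_mult exp_add[symmetric] by (intro arg_cong[where f = exp]) simp
    \<comment> \<open>The exponent of \<open>det ?Y\<close> is \<open>(k + 1/2) + s - 3/2\<close>,
      that is \<open>\<alpha> + s - 1/2\<close>.\<close>
    have p: "det (T ** ?Y) powr (real (k + 2) - 3/2) * det ?Y powr s / det ?Y powr (3/2)
        = det T powr (real k + 1/2) * det ?Y powr (\<alpha> + s - 1/2)"
    proof -
      have "real (k + 2) - 3/2 = real k + 1/2" by simp
      then have "det (T ** ?Y) powr (real (k + 2) - 3/2) = det T powr (real k + 1/2) * det ?Y powr (real k + 1/2)"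
        using dT dY by (simp only: det_mul powr_mult less_imp_le)
      moreover have "det ?Y powr (real k + 1/2) * det ?Y powr s / det ?Y powr (3/2) = det ?Y powr (\<alpha> + s - 1/2)"
        by (simp add: \<alpha>_def powr_add[symmetric] powr_diff[symmetric] algebra_simps)
      ultimately show ?thesis by (simp only: mult.assoc times_divide_eq_right[symmetric])
    qed
    show ?thesis
    proof -
      have "exp (- 2 * pi * trace (T ** ?Y)) * det (T ** ?Y) powr (real (k + 2) - 3/2) * det ?Y powr s / det ?Y powr (3/2)
          = exp (- 2 * pi * trace (T ** ?Y)) * (det T powr (real k + 1/2) * det ?Y powr (\<alpha> + s - 1/2))"
        by (simp only: p[symmetric] mult.assoc times_divide_eq_right)
      then have "sturm_integrand (k + 2) (maass_op k h) T s y =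
          c T * of_real (maass_weight k T ?Y * exp (- 2 * pi * trace (T ** ?Y))) *
          of_real (exp (- 2 * pi * trace (T ** ?Y)) * (det T powr (real k + 1/2) * det ?Y powr (\<alpha> + s - 1/2)))"
        by (simp only: sturm_integrand_def Let_def fourier_coeff_maass_op[OF hs T Y])
      then show ?thesis
        unfolding w[symmetric] e using True by (simp only: of_real_mult indicator_simps scaleR_one mult_ac)
    qed
  qed simp
  ultimately show ?thesis by (simp only: dS \<alpha>_def)
qed

text \<open>In weight 3 the two powers of the determinant cancel, which leaves the cone integral at
  \<open>\<tau> = 3/2\<close>. Positivity ensures that \<open>inverse\<close> in
  \<open>sturm_coeff\<close> does not take its default value 0.\<close>

lemma sturm_const_pos: "sturm_const 3 > 0"
proof -
  define S :: "real^2^2" where "S = (4 * pi) *\<^sub>R mat 1"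
  have S: "posdef S" by (simp add: S_def posdef_iff mat_def)
  have "has_bochner_integral lborel
    (\<lambda>y. indicator pos_cone y *\<^sub>R (exp (- trace (S ** sym_mat y)) * det (sym_mat y) powr (3/2 - 3/2)))
    (cone_gamma (3/2) * det S powr - (3/2))"
    by (rule has_bochner_integral_pos_cone[OF S]) simp
  moreover have "indicator pos_cone y *\<^sub>R (exp (- trace (S ** sym_mat y)) * det (sym_mat y) powr (3/2 - 3/2)) =
    indicator pos_cone y *\<^sub>R (exp (- 4 * pi * trace (sym_mat y)) * det (sym_mat y) powr (real 3 - 3/2)
       / det (sym_mat y) powr (3/2))" for y
  proof (cases "y \<in> pos_cone")
    case True
    then have "det (sym_mat y) > 0" by (simp add: pos_cone_def posdef_det_pos)
    then show ?thesis by (simp add: S_def)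
  qed simp
  ultimately have "sturm_const 3 = cone_gamma (3/2) * det S powr - (3/2)"
    unfolding sturm_const_def set_lebesgue_integral_def by (simp only: has_bochner_integral_iff)
  also have "\<dots> > 0"
    using posdef_det_pos[OF S] by (simp add: cone_gamma_def Gamma_real_pos)
  finally show ?thesis .
qed

theorem theorem1p1:
  fixes k \<kappa> :: nat and \<Gamma> :: "int_mat4 set" and h :: "complex^2^2 \<Rightarrow> complex"
  assumes "subgroup \<Gamma> Sp2Z" and "finite (rcosets\<^bsub>Sp2Z\<^esub> \<Gamma>)" and "Gamma_inf \<subseteq> \<Gamma>"
    and "cusp_form \<Gamma> k h" and "\<kappa> = k + 2"
  shows "(4 \<le> \<kappa> \<longrightarrow>
            (\<forall>T. half_integral T \<and> posdef T \<longrightarrow>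
               sturm_converges \<kappa> (maass_op k h) T 0 \<and>
               sturm_coeff \<kappa> (maass_op k h) T 0 = 0 \<and>
               has_sturm_coeff \<kappa> (maass_op k h) T 0)) \<and>
         (\<kappa> = 3 \<and> (\<exists>Z\<in>siegel_H. h Z \<noteq> 0) \<longrightarrow>
            (\<forall>T. half_integral T \<and> posdef T \<longrightarrow> (\<exists>a. has_sturm_coeff \<kappa> (maass_op k h) T a)) \<and>
            (\<exists>T a. half_integral T \<and> posdef T \<and> a \<noteq> 0 \<and> has_sturm_coeff \<kappa> (maass_op k h) T a))"
proof -
  obtain c where hs: "\<And>Z. Z \<in> siegel_H \<Longrightarrow>
      ((\<lambda>T. c T * cexp T Z) has_sum h Z) {T. posdef T \<and> half_integral T}"
    by (rule cusp_form_fourier_expansion[OF assms(3,4)]) blast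
  note int = has_bochner_integral_sturm_integrand[OF hs, of _ k]
  have conv: "sturm_converges \<kappa> (maass_op k h) T s" if "half_integral T" "posdef T" "real k + s > 1" for T s
    using int[of T s] that
    by (simp only: sturm_converges_def set_integrable_def assms(5) has_bochner_integral_iff)
  \<comment> \<open>For \<open>k = 1\<close> every \<open>s > 0\<close> converges, whereas the
    condition \<open>k + s > 1\<close> at \<open>s = 0\<close> requires
    \<open>k \<ge> 2\<close>.\<close>
  have ev: "\<forall>\<^sub>F s in at_right 0. sturm_converges \<kappa> (maass_op k h) T s"
    if "half_integral T" "posdef T" "k \<ge> 1" for T
    using eventually_at_right_less[of 0]
  proof eventually_elim
    case (elim s)
    with that show ?case by (intro conv) auto
  qed
  have coeff: "sturm_coeff \<kappa> (maass_op k h) T s = inverse (of_real (sturm_const \<kappa>)) *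
      (c T * of_real (det T powr (real k + 1/2) * (s * (s - 1/2) *
       (cone_gamma (real k - 1/2 + s) * (16 * pi\<^sup>2 * det T) powr - (real k - 1/2 + s)))))"
    if "half_integral T" "posdef T" "real k + s > 1" for T s
    using int[of T s] that
    by (simp only: sturm_coeff_def set_lebesgue_integral_def assms(5) has_bochner_integral_iff)
  show ?thesis
  proof (intro conjI impI allI)
    fix T assume \<kappa>: "4 \<le> \<kappa>" and "half_integral T \<and> posdef T"
    then have T: "half_integral T" "posdef T" and k: "real k + 0 > 1" "k \<ge> 1" using assms(5) by auto
    show "sturm_converges \<kappa> (maass_op k h) T 0" using conv[OF T k(1)] .
    show 0: "sturm_coeff \<kappa> (maass_op k h) T 0 = 0" using coeff[OF T k(1)] by simp
    show "has_sturm_coeff \<kappa> (maass_op k h) T 0"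
      using has_sturm_coeff_iff[OF conv[OF T k(1)] ev[OF T k(2)]] 0 by simp
  next
    assume \<kappa>: "\<kappa> = 3 \<and> (\<exists>Z\<in>siegel_H. h Z \<noteq> 0)"
    then have k: "k = 1" using assms(5) by simp
    \<comment> \<open>The limit of the closed form as \<open>s\<close> tends to 0, with
      \<open>pi\<close> in place of \<open>s * cone_gamma (1/2 + s)\<close>. It is a nonzero
      multiple of \<open>c T\<close>. The shapes \<open>0 - 1/2\<close> and \<open>1/2 + 0\<close>
      are those produced by the limit rules.\<close>
    define a where "a T = inverse (of_real (sturm_const \<kappa>)) *
      (c T * of_real (det T powr (3/2) * ((0 - 1/2) * (pi * (16 * pi\<^sup>2 * det T) powr - (1/2 + 0)))))" for T
    have sc: "has_sturm_coeff \<kappa> (maass_op k h) T (a T)" if T: "half_integral T" "posdef T" for T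
      unfolding has_sturm_coeff_def
    proof
      show "\<forall>\<^sub>F s in at_right 0. sturm_converges \<kappa> (maass_op k h) T s" using ev[OF T] k by simp
      have D: "16 * pi\<^sup>2 * det T > 0" using posdef_det_pos[OF T(2)] by simp
      have "((\<lambda>s. inverse (of_real (sturm_const \<kappa>)) *
          (c T * of_real (det T powr (3/2) * ((s - 1/2) * (s * cone_gamma (1/2 + s) * (16 * pi\<^sup>2 * det T) powr - (1/2 + s))))))
          \<longlongrightarrow> a T) (at_right 0)"
        unfolding a_def using D by (intro tendsto_intros tendsto_cone_gamma_pole) auto
      moreover have "\<forall>\<^sub>F s in at_right 0. inverse (of_real (sturm_const \<kappa>)) *
          (c T * of_real (det T powr (3/2) * ((s - 1/2) * (s * cone_gamma (1/2 + s) * (16 * pi\<^sup>2 * det T) powr - (1/2 + s)))))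
          = sturm_coeff \<kappa> (maass_op k h) T s"
        using eventually_at_right_less[of 0]
      proof eventually_elim
        case (elim s)
        then show ?case
          using coeff[OF T, of s] by (simp add: k mult_ac)
      qed
      ultimately show "(sturm_coeff \<kappa> (maass_op k h) T \<longlongrightarrow> a T) (at_right 0)"
        by (rule Lim_transform_eventually)
    qed
    then show "\<exists>a. has_sturm_coeff \<kappa> (maass_op k h) T a" if "half_integral T \<and> posdef T" for T
      using that by blast
    \<comment> \<open>If all coefficients vanished, the expansion would sum to 0 at the point where
      \<open>h\<close> is nonzero.\<close>
    obtain T where T: "posdef T" "half_integral T" "c T \<noteq> 0"
    proof (rule ccontr)
      assume "\<not> thesis"
      with that have 0: "c T = 0" if "posdef T" "half_integral T" for T using that by blast
      obtain Z where Z: "Z \<in> siegel_H" "h Z \<noteq> 0" using \<kappa> by blast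
      have "((\<lambda>T. c T * cexp T Z) has_sum 0) {T. posdef T \<and> half_integral T}"
        by (rule has_sum_0) (use 0 in auto)
      with hs[OF Z(1)] have "h Z = 0" by (rule has_sum_unique)
      with Z show False by simp
    qed
    moreover have "a T \<noteq> 0"
      using T posdef_det_pos[OF T(1)] sturm_const_pos \<kappa> by (simp add: a_def)
    ultimately show "\<exists>T a. half_integral T \<and> posdef T \<and> a \<noteq> 0 \<and> has_sturm_coeff \<kappa> (maass_op k h) T a"
      using sc by blast
  qed
qed

end
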